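(* Let $T$ be an integral domain, $M$ a maximal ideal of $T$, $K=T/M$ its residue field, $\phi:T\to K$ the canonical surjection, $D$ a proper subring of $K$, $k$ the quotient field of $D$ (inside $K$), and $R:=\phi^{-1}(D)$. Then: (1) If $R$ is Clifford regular, then so are $T$ and $D$, and $[K:k]\leq 2$. If $R$ is Boole regular, then so are $T$ and $D$, and $[K:k]\leq 2$. (2) Assume $D=k$. If $T$ is a valuation domain, then $R$ is Clifford regular if and only if $[K:k]=2$. If $T$ is a strongly discrete valuation domain, then $R$ is Boole regular if and only if $[K:k]=2$.
   Context: For an integral domain $A$, the class semigroup $\mathcal{S}(A)$ is the commutative multiplicative semigroup of nonzero fractional ideals of $A$ modulo its subsemigroup of nonzero principal fractional ideals. A commutative semigroup $S$ is Clifford if for every $x\in S$ there is $a\in S$ with $x^2a=x$, and Boolean if $x=x^2$ for all $x\in S$. $A$ is Clifford (resp., Boole) regular if $\mathcal{S}(A)$ is Clifford (resp., Boolean). A domain is strongly discrete if it has no nonzero idempotent prime ideals.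
   Formalization: The bound [K:k] ≤ 2 in (1) and all of (2) are stated for M ≠ 0 (T not a field); for M = 0 they fail, e.g. T = K = ℂ, D = k = R = ℚ, where R is Boole regular but [K:k] is infinite. *)

theory Defs
  imports "HOL-Algebra.Algebra"
begin

text \<open>
  An integral domain is given as a subring \<open>A\<close> of a field \<open>F\<close>; its quotient field is
  taken inside \<open>F\<close>. The field \<open>F\<close> may be larger than the quotient field of \<open>A\<close>: fractional
  ideals, the class semigroup and the regularity notions below depend only on the
  quotient field.
\<close>

definition quot_field :: "('a, 'b) ring_scheme \<Rightarrow> 'a set \<Rightarrow> 'a set" where
  "quot_field F A = {a \<otimes>\<^bsub>F\<^esub> inv\<^bsub>F\<^esub> b | a b. a \<in> A \<and> b \<in> A \<and> b \<noteq> \<zero>\<^bsub>F\<^esub>}"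

definition fractional_ideal :: "('a, 'b) ring_scheme \<Rightarrow> 'a set \<Rightarrow> 'a set \<Rightarrow> bool" where
  "fractional_ideal F A I \<longleftrightarrow>
     I \<subseteq> quot_field F A \<and>
     subgroup I (add_monoid F) \<and>
     (\<forall>a\<in>A. \<forall>x\<in>I. a \<otimes>\<^bsub>F\<^esub> x \<in> I) \<and>
     (\<exists>d\<in>A. d \<noteq> \<zero>\<^bsub>F\<^esub> \<and> (\<forall>x\<in>I. d \<otimes>\<^bsub>F\<^esub> x \<in> A))"

definition nonzero_fractional_ideals :: "('a, 'b) ring_scheme \<Rightarrow> 'a set \<Rightarrow> 'a set set" where
  "nonzero_fractional_ideals F A = {I. fractional_ideal F A I \<and> I \<noteq> {\<zero>\<^bsub>F\<^esub>}}"

definition nonzero_principal_fractional_ideals ::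
    "('a, 'b) ring_scheme \<Rightarrow> 'a set \<Rightarrow> 'a set set" where
  "nonzero_principal_fractional_ideals F A =
     {{a \<otimes>\<^bsub>F\<^esub> x | a. a \<in> A} | x. x \<in> quot_field F A \<and> x \<noteq> \<zero>\<^bsub>F\<^esub>}"

text \<open>
  The product of two fractional ideals is \<^const>\<open>ideal_prod\<close> taken in \<open>F\<close>: that constant
  denotes the set of all nonempty finite sums of products, whichever subsets of the ring it is
  applied to. Two fractional ideals are identified if they agree up to factors from the
  subsemigroup of nonzero principal ones.
\<close>

definition class_rel :: "('a, 'b) ring_scheme \<Rightarrow> 'a set \<Rightarrow> ('a set \<times> 'a set) set" where
  "class_rel F A =
     {(I, J). I \<in> nonzero_fractional_ideals F A \<and> J \<in> nonzero_fractional_ideals F A \<and>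
        (\<exists>P \<in> nonzero_principal_fractional_ideals F A.
         \<exists>Q \<in> nonzero_principal_fractional_ideals F A. I \<cdot>\<^bsub>F\<^esub> P = J \<cdot>\<^bsub>F\<^esub> Q)}"

definition class_semigroup :: "('a, 'b) ring_scheme \<Rightarrow> 'a set \<Rightarrow> 'a set set monoid" where
  "class_semigroup F A =
     \<lparr>carrier = nonzero_fractional_ideals F A // class_rel F A,
      monoid.mult = (\<lambda>x y. \<Union>I\<in>x. \<Union>J\<in>y. class_rel F A `` {I \<cdot>\<^bsub>F\<^esub> J}),
      one = class_rel F A `` {A}\<rparr>"

definition clifford_semigroup :: "('s, 'm) monoid_scheme \<Rightarrow> bool" where
  "clifford_semigroup S \<longleftrightarrow>
     (\<forall>x\<in>carrier S. \<exists>a\<in>carrier S. (x \<otimes>\<^bsub>S\<^esub> x) \<otimes>\<^bsub>S\<^esub> a = x)"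

definition boolean_semigroup :: "('s, 'm) monoid_scheme \<Rightarrow> bool" where
  "boolean_semigroup S \<longleftrightarrow> (\<forall>x\<in>carrier S. x = x \<otimes>\<^bsub>S\<^esub> x)"

definition clifford_regular :: "('a, 'b) ring_scheme \<Rightarrow> 'a set \<Rightarrow> bool" where
  "clifford_regular F A \<longleftrightarrow> clifford_semigroup (class_semigroup F A)"

definition boole_regular :: "('a, 'b) ring_scheme \<Rightarrow> 'a set \<Rightarrow> bool" where
  "boole_regular F A \<longleftrightarrow> boolean_semigroup (class_semigroup F A)"

definition valuation_domain :: "('a, 'b) ring_scheme \<Rightarrow> 'a set \<Rightarrow> bool" where
  "valuation_domain F A \<longleftrightarrow>
     (\<forall>x \<in> quot_field F A. x \<noteq> \<zero>\<^bsub>F\<^esub> \<longrightarrow> x \<in> A \<or> inv\<^bsub>F\<^esub> x \<in> A)"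

definition strongly_discrete :: "('a, 'b) ring_scheme \<Rightarrow> bool" where
  "strongly_discrete A \<longleftrightarrow>
     (\<forall>P. primeideal P A \<and> P \<noteq> {\<zero>\<^bsub>A\<^esub>} \<longrightarrow> P \<cdot>\<^bsub>A\<^esub> P \<noteq> P)"

end

theory Submission
  imports Defs
begin

text \<open>
  Let \<open>I\<close> range over the nonzero fractional ideals of a domain. Clifford regularity means that
  \<open>I = I\<^sup>2 J\<close> for some \<open>J\<close>, and the largest possible \<open>J\<close> is the residual \<open>(I : I\<^sup>2)\<close>; Boole regularity
  means \<open>I\<^sup>2 = c I\<close> for some nonzero \<open>c\<close>. This turns both notions into statements about individual
  ideals, into which the domain enters only through its fractional ideals and its quotient field
  (\<open>clifford_regular_iff\<close>, \<open>boole_regular_iff\<close>).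

  Descent from \<open>R\<close> to \<open>T\<close>. If \<open>M\<close> contains some \<open>m \<noteq> 0\<close>, then \<open>m T \<subseteq> R\<close>, so every fractional ideal of \<open>T\<close> is
  one of \<open>R\<close> (\<open>overring_with_conductor\<close>). If \<open>M = 0\<close>, then \<open>T\<close> is a field.

  Descent from \<open>R\<close> to \<open>D\<close>. The preimage \<open>J\<close> of a \<open>D\<close>-submodule \<open>V\<close> of \<open>K\<close> contains \<open>M\<close> properly if \<open>V \<noteq> 0\<close>, so
  \<open>J T = T\<close>. Therefore \<open>(J : J\<^sup>2)\<close>, and likewise any \<open>c\<close> with \<open>J\<^sup>2 = c J\<close>, lies in \<open>T\<close>, and
  the residue map \<open>\<phi>\<close> carries the relation for \<open>J\<close> to the one for \<open>V\<close> (\<open>clifford_ideal_of_preimage\<close>, \<open>square_similar_of_preimage\<close>).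

  The degree. If \<open>M \<noteq> 0\<close>, then this applies to every nonzero \<open>k\<close>-subspace \<open>V\<close> of \<open>K\<close> and gives \<open>w \<noteq> 0\<close> with
  \<open>w V\<^sup>2 \<subseteq> V\<close>. For \<open>V = k + k y\<close> it follows that \<open>V\<close> is a field \<open>E\<close>; and \<open>V = E + k z\<close> with \<open>z \<notin> E\<close>
  would give \<open>E = k\<close>. Thus \<open>K = k\<close> or \<open>K = k + k y\<close> (\<open>dimension_2_of_square_residuals\<close>).

  The converse for a valuation domain \<open>T\<close> and \<open>D = k\<close>. When \<open>[K : k] = 2\<close>, a fractional ideal of \<open>R\<close> is either a
  fractional ideal of \<open>T\<close> or principal over \<open>R\<close> (\<open>fractional_ideal_dichotomy\<close>). If \<open>I = x R\<close>, then
  \<open>I\<^sup>2 = x I\<close>. A fractional ideal \<open>I\<close> of \<open>T\<close> that is generated by one \<open>x\<close> over \<open>(I : I)\<close> has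
  \<open>I\<^sup>2 = x I\<close>. Otherwise a divisibility argument gives \<open>I \<subseteq> I\<^sup>2 (I : I\<^sup>2)\<close>, so \<open>R\<close> is Clifford regular; and this case does not occur if \<open>T\<close> is
  strongly discrete, as then the maximal ideal of \<open>(I : I)\<close>, a nonzero prime ideal of \<open>T\<close>, is generated
  over \<open>(I : I)\<close> by one of its elements (\<open>strongly_discrete_valuation_square\<close>). So \<open>R\<close> is Boole regular.
\<close>

(* The symbol also denotes strict inclusion of multisets; below it is multiplication of a
   subset by an element. *)
no_notation subset_mset (infix \<open><#\<close> 50)

section \<open>Products of subsets of a field\<close>

context field
begin

lemma field_inv:
  assumes "x \<in> carrier R" "x \<noteq> \<zero>"
  shows "inv x \<in> carrier R" "x \<otimes> inv x = \<one>" "inv x \<otimes> x = \<one>" "inv x \<noteq> \<zero>"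
proof -
  have "x \<in> Units R" using assms field_Units by simp
  then show "inv x \<in> carrier R" "x \<otimes> inv x = \<one>" "inv x \<otimes> x = \<one>" by auto
  then show "inv x \<noteq> \<zero>" using assms(1) by (metis one_not_zero r_null)
qed

lemma inv_cancel:
  assumes "c \<in> carrier R" "c \<noteq> \<zero>" "x \<in> carrier R"
  shows "inv c \<otimes> (c \<otimes> x) = x" "c \<otimes> (inv c \<otimes> x) = x"
  using assms by (simp_all add: m_assoc[symmetric] field_inv)

lemma inv_mult:
  assumes "x \<in> carrier R" "x \<noteq> \<zero>" "y \<in> carrier R" "y \<noteq> \<zero>"
  shows "inv (x \<otimes> y) = inv x \<otimes> inv y"
proof -
  have "(x \<otimes> y) \<otimes> (inv x \<otimes> inv y) = (x \<otimes> inv x) \<otimes> (y \<otimes> inv y)"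
    using assms field_inv(1) by (simp add: m_ac)
  then show ?thesis using comm_inv_char[of "x \<otimes> y" "inv x \<otimes> inv y"] assms by (simp add: field_inv)
qed

lemma mem_l_coset_iff:
  assumes "c \<in> carrier R" "c \<noteq> \<zero>" "I \<subseteq> carrier R" "y \<in> carrier R"
  shows "y \<in> c <# I \<longleftrightarrow> inv c \<otimes> y \<in> I"
proof
  assume "y \<in> c <# I"
  then obtain i where "i \<in> I" "y = c \<otimes> i" unfolding l_coset_def by blast
  then show "inv c \<otimes> y \<in> I" using assms by (simp add: inv_cancel subset_iff)
next
  assume "inv c \<otimes> y \<in> I"
  then show "y \<in> c <# I"
    unfolding l_coset_def using assms inv_cancel(2)[of c y] by force
qed

lemma l_coset_memI: "i \<in> I \<Longrightarrow> c \<otimes> i \<in> c <# I"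
  unfolding l_coset_def by blast

lemma l_coset_carrier:
  "c \<in> carrier R \<Longrightarrow> I \<subseteq> carrier R \<Longrightarrow> c <# I \<subseteq> carrier R"
  unfolding l_coset_def by blast

lemma l_coset_assoc:
  assumes "I \<subseteq> carrier R" "a \<in> carrier R" "b \<in> carrier R"
  shows "a <# (b <# I) = (a \<otimes> b) <# I"
  using assms by (force simp: l_coset_def m_assoc)

lemma l_coset_one: "I \<subseteq> carrier R \<Longrightarrow> \<one> <# I = I"
  by (force simp: l_coset_def)

lemma ideal_prod_closed:
  assumes "I \<subseteq> carrier R" "J \<subseteq> carrier R"
  shows "I \<cdot> J \<subseteq> carrier R"
proof
  fix s assume "s \<in> I \<cdot> J"
  then show "s \<in> carrier R" by induct (use assms in auto)
qed

lemma ideal_prod_subsetI: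
  assumes "\<And>i j. i \<in> I \<Longrightarrow> j \<in> J \<Longrightarrow> i \<otimes> j \<in> S"
    and "\<And>x y. x \<in> S \<Longrightarrow> y \<in> S \<Longrightarrow> x \<oplus> y \<in> S"
  shows "I \<cdot> J \<subseteq> S"
proof
  fix s assume "s \<in> I \<cdot> J"
  then show "s \<in> S" by induct (use assms in auto)
qed

text \<open>
  Fixing the factor from \<open>J\<close>, the set of \<open>s\<close> with \<open>s \<otimes> j \<in> S\<close> is closed under addition; so
  it is enough to look at the products \<open>s = h \<otimes> i\<close>.
\<close>
lemma ideal_prod3_subsetI:
  assumes "H \<subseteq> carrier R" "I \<subseteq> carrier R" "J \<subseteq> carrier R"
    and prod: "\<And>h i j. h \<in> H \<Longrightarrow> i \<in> I \<Longrightarrow> j \<in> J \<Longrightarrow> h \<otimes> i \<otimes> j \<in> S"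
    and add: "\<And>x y. x \<in> S \<Longrightarrow> y \<in> S \<Longrightarrow> x \<oplus> y \<in> S"
  shows "H \<cdot> I \<cdot> J \<subseteq> S"
proof (rule ideal_prod_subsetI)
  fix s j assume s: "s \<in> H \<cdot> I" and j: "j \<in> J"
  have "H \<cdot> I \<subseteq> {s \<in> carrier R. s \<otimes> j \<in> S}"
    by (rule ideal_prod_subsetI) (use assms j in \<open>auto simp: l_distr subset_iff\<close>)
  then show "s \<otimes> j \<in> S" using s by blast
qed (rule add)

lemma ideal_prod_mono:
  assumes "I \<subseteq> I'" "J \<subseteq> J'"
  shows "I \<cdot> J \<subseteq> I' \<cdot> J'"
  by (rule ideal_prod_subsetI) (use assms in \<open>auto intro: ideal_prod.intros\<close>)

lemma l_coset_ideal_prod: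
  assumes "I \<subseteq> carrier R" "J \<subseteq> carrier R" "c \<in> carrier R" "d \<in> carrier R"
  shows "(c <# I) \<cdot> (d <# J) = (c \<otimes> d) <# (I \<cdot> J)"
proof
  show "(c <# I) \<cdot> (d <# J) \<subseteq> (c \<otimes> d) <# (I \<cdot> J)"
  proof (rule ideal_prod_subsetI)
    fix x y assume "x \<in> c <# I" "y \<in> d <# J"
    then obtain i j where ij: "i \<in> I" "j \<in> J" "x = c \<otimes> i" "y = d \<otimes> j"
      unfolding l_coset_def by blast
    then have "x \<otimes> y = (c \<otimes> d) \<otimes> (i \<otimes> j)" using assms by (simp add: m_ac subset_iff)
    then show "x \<otimes> y \<in> (c \<otimes> d) <# (I \<cdot> J)"
      using ij by (simp add: l_coset_memI ideal_prod.prod)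
  next
    fix x y assume "x \<in> (c \<otimes> d) <# (I \<cdot> J)" "y \<in> (c \<otimes> d) <# (I \<cdot> J)"
    then obtain s t where st: "s \<in> I \<cdot> J" "t \<in> I \<cdot> J" "x = (c \<otimes> d) \<otimes> s" "y = (c \<otimes> d) \<otimes> t"
      unfolding l_coset_def by blast
    then have "x \<oplus> y = (c \<otimes> d) \<otimes> (s \<oplus> t)"
      using ideal_prod_closed[OF assms(1,2)] assms(3,4) by (simp add: r_distr subset_iff)
    then show "x \<oplus> y \<in> (c \<otimes> d) <# (I \<cdot> J)"
      using st by (simp add: l_coset_memI ideal_prod.sum)
  qed
next
  have "I \<cdot> J \<subseteq> {s \<in> carrier R. (c \<otimes> d) \<otimes> s \<in> (c <# I) \<cdot> (d <# J)}"
  proof (rule ideal_prod_subsetI)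
    fix i j assume ij: "i \<in> I" "j \<in> J"
    then have "(c \<otimes> d) \<otimes> (i \<otimes> j) = (c \<otimes> i) \<otimes> (d \<otimes> j)" using assms by (simp add: m_ac subset_iff)
    then show "i \<otimes> j \<in> {s \<in> carrier R. (c \<otimes> d) \<otimes> s \<in> (c <# I) \<cdot> (d <# J)}"
      using ij assms by (auto simp: l_coset_memI ideal_prod.prod)
  qed (use assms in \<open>auto simp: r_distr intro: ideal_prod.sum\<close>)
  then show "(c \<otimes> d) <# (I \<cdot> J) \<subseteq> (c <# I) \<cdot> (d <# J)" unfolding l_coset_def by blast
qed

end

section \<open>Regularity of a single subset\<close>

context field
begin

text \<open>
  The residual \<open>(I : I\<^sup>2)\<close>, formed in the whole field. A nonzero element of \<open>I\<close> forces it into any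
  subfield that contains \<open>I\<close>, so that the condition on a single fractional ideal below makes no
  reference to the domain; this is what lets it be compared between a domain and its overrings.
\<close>
definition square_residual :: "'a set \<Rightarrow> 'a set" where
  "square_residual I = {x \<in> carrier R. \<forall>i\<in>I. \<forall>j\<in>I. i \<otimes> j \<otimes> x \<in> I}"

definition clifford_ideal :: "'a set \<Rightarrow> bool" where
  "clifford_ideal I \<longleftrightarrow> I \<subseteq> I \<cdot> I \<cdot> square_residual I"

lemma clifford_ideal_residual_nonzero:
  assumes "clifford_ideal I" "I \<subseteq> carrier R" "x \<in> I" "x \<noteq> \<zero>"
  shows "\<exists>w\<in>square_residual I. w \<noteq> \<zero>"
proof (rule ccontr)
  assume "\<not> ?thesis"
  then have "square_residual I \<subseteq> {\<zero>}" by blast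
  then have "I \<cdot> I \<cdot> square_residual I \<subseteq> {\<zero>}"
    by (intro ideal_prod3_subsetI)
      (use assms(2) in \<open>auto simp: subset_iff square_residual_def\<close>)
  then show False using assms(1,3,4) unfolding clifford_ideal_def by blast
qed

lemma clifford_idealI:
  assumes "I \<subseteq> carrier R" "J \<subseteq> carrier R" "I \<cdot> I \<cdot> J = I"
  shows "clifford_ideal I"
proof -
  have "J \<subseteq> square_residual I"
    unfolding square_residual_def using assms ideal_prod.prod[of _ I _ I R]
      ideal_prod.prod[of _ "I \<cdot> I" _ J R] by auto
  then have "I \<cdot> I \<cdot> J \<subseteq> I \<cdot> I \<cdot> square_residual I" by (rule ideal_prod_mono[OF order_refl])
  then show ?thesis unfolding clifford_ideal_def using assms(3) by simp
qed

text \<open>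
  If \<open>I\<^sup>2 = c I\<close>, then \<open>I\<^sup>2 I = c\<^sup>2 I\<close>, so \<open>J = c\<^sup>-\<^sup>2 I\<close> satisfies \<open>I\<^sup>2 J = I\<close>.
\<close>
lemma square_similar_imp_clifford_ideal:
  assumes I: "I \<subseteq> carrier R" and c: "c \<in> carrier R" "c \<noteq> \<zero>" and eq: "I \<cdot> I = c <# I"
  shows "clifford_ideal I"
proof (rule clifford_idealI)
  let ?d = "inv (c \<otimes> c)"
  have cc: "c \<otimes> c \<in> carrier R" "c \<otimes> c \<noteq> \<zero>" using c by (simp_all add: integral_iff)
  note d = field_inv[OF cc]
  show "?d <# I \<subseteq> carrier R" using d I by (rule_tac l_coset_carrier)
  have "I \<cdot> I \<cdot> (?d <# I) = (c <# I) \<cdot> (?d <# I)" unfolding eq ..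
  also have "\<dots> = (c \<otimes> ?d) <# (I \<cdot> I)" using c d I by (simp add: l_coset_ideal_prod)
  also have "\<dots> = (c \<otimes> ?d \<otimes> c) <# I" unfolding eq using c d I by (simp add: l_coset_assoc)
  also have "c \<otimes> ?d \<otimes> c = \<one>" using c d by (simp add: m_ac)
  finally show "I \<cdot> I \<cdot> (?d <# I) = I" using I by (simp add: l_coset_one)
qed (rule I)

text \<open>
  The hypothesis on \<open>x\<close> says that every \<open>x\<^sup>-\<^sup>1 y\<close> multiplies \<open>I\<close> into itself, that is, \<open>I\<close> is
  generated by \<open>x\<close> over the ring \<open>(I : I)\<close>. Then \<open>I\<^sup>2 = x (I : I) I = x I\<close>.
\<close>
lemma square_of_principal_over_multipliers:
  assumes I: "I \<subseteq> carrier R" and add: "\<And>u v. u \<in> I \<Longrightarrow> v \<in> I \<Longrightarrow> u \<oplus> v \<in> I"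
    and x: "x \<in> I" "x \<noteq> \<zero>"
    and gen: "\<And>y i. y \<in> I \<Longrightarrow> i \<in> I \<Longrightarrow> inv x \<otimes> y \<otimes> i \<in> I"
  shows "I \<cdot> I = x <# I"
proof
  have xc: "x \<in> carrier R" using I x by blast
  show "I \<cdot> I \<subseteq> x <# I"
  proof (rule ideal_prod_subsetI)
    fix y i assume yi: "y \<in> I" "i \<in> I"
    then have "y \<otimes> i = x \<otimes> (inv x \<otimes> y \<otimes> i)"
      using I x xc by (simp add: m_assoc field_inv inv_cancel subset_iff)
    then show "y \<otimes> i \<in> x <# I" using gen[OF yi] by (simp add: l_coset_memI)
  next
    fix u v assume "u \<in> x <# I" "v \<in> x <# I"
    then obtain i j where "i \<in> I" "j \<in> I" "u = x \<otimes> i" "v = x \<otimes> j" unfolding l_coset_def by blast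
    then show "u \<oplus> v \<in> x <# I"
      using add I xc l_coset_memI[of "i \<oplus> j" I x] by (simp add: r_distr subset_iff)
  qed
  show "x <# I \<subseteq> I \<cdot> I" unfolding l_coset_def using x ideal_prod.prod[of x I _ I R] by blast
qed

end

section \<open>The class semigroup through individual fractional ideals\<close>

locale domain_in_field = field L for L (structure) +
  fixes A
  assumes subring_A: "subring A L"
begin

lemmas A_props = subringE[OF subring_A]

lemma A_carrier: "a \<in> A \<Longrightarrow> a \<in> carrier L"
  using A_props(1) by blast

lemma A_cring: "cring (L\<lparr>carrier := A\<rparr>)"
  using subcring_iff[OF A_props(1)] subcringI'[OF subring_A] by blast

lemma A_mult_nonzero:
  assumes "a \<in> A" "b \<in> A" "a \<noteq> \<zero>" "b \<noteq> \<zero>"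
  shows "a \<otimes> b \<in> A" "a \<otimes> b \<noteq> \<zero>"
  using assms by (simp_all add: A_props(6) integral_iff A_carrier)

abbreviation "Q \<equiv> quot_field L A"
abbreviation "FI \<equiv> nonzero_fractional_ideals L A"

text \<open>
  Elements of the quotient field are handled through their denominators: this form makes
  closure under the field operations a matter of multiplying denominators.
\<close>
lemma quot_field_iff:
  "x \<in> Q \<longleftrightarrow> x \<in> carrier L \<and> (\<exists>b\<in>A. b \<noteq> \<zero> \<and> b \<otimes> x \<in> A)"
proof
  assume "x \<in> Q"
  then obtain a b where ab: "a \<in> A" "b \<in> A" "b \<noteq> \<zero>" "x = a \<otimes> inv b"
    unfolding quot_field_def by blast
  then have "b \<otimes> x = a" by (simp add: m_lcomm field_inv A_carrier)
  then show "x \<in> carrier L \<and> (\<exists>b\<in>A. b \<noteq> \<zero> \<and> b \<otimes> x \<in> A)"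
    using ab by (auto simp: A_carrier field_inv)
next
  assume "x \<in> carrier L \<and> (\<exists>b\<in>A. b \<noteq> \<zero> \<and> b \<otimes> x \<in> A)"
  then obtain b where b: "x \<in> carrier L" "b \<in> A" "b \<noteq> \<zero>" "b \<otimes> x \<in> A" by blast
  then have "x = (b \<otimes> x) \<otimes> inv b"
    by (simp add: m_comm[of "b \<otimes> x"] field_inv inv_cancel A_carrier)
  then show "x \<in> Q" unfolding quot_field_def using b by blast
qed

lemma Q_carrier: "x \<in> Q \<Longrightarrow> x \<in> carrier L"
  by (simp add: quot_field_iff)

lemma A_in_Q: "A \<subseteq> Q"
  using A_props(3) by (auto simp: quot_field_iff A_carrier intro!: bexI[of _ \<one>])

lemma Q_mult: assumes "x \<in> Q" "y \<in> Q" shows "x \<otimes> y \<in> Q"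
proof -
  obtain b c where b: "b \<in> A" "b \<noteq> \<zero>" "b \<otimes> x \<in> A" "c \<in> A" "c \<noteq> \<zero>" "c \<otimes> y \<in> A"
    using assms quot_field_iff by meson
  have "(b \<otimes> c) \<otimes> (x \<otimes> y) = (b \<otimes> x) \<otimes> (c \<otimes> y)"
    using b assms by (simp add: m_ac A_carrier Q_carrier)
  then have "(b \<otimes> c) \<otimes> (x \<otimes> y) \<in> A" using b A_props(6) by simp
  moreover have "b \<otimes> c \<in> A" "b \<otimes> c \<noteq> \<zero>" using b by (simp_all add: A_mult_nonzero)
  ultimately show ?thesis using assms by (auto simp: quot_field_iff)
qed

lemma Q_add: assumes "x \<in> Q" "y \<in> Q" shows "x \<oplus> y \<in> Q"
proof -
  obtain b c where b: "b \<in> A" "b \<noteq> \<zero>" "b \<otimes> x \<in> A" "c \<in> A" "c \<noteq> \<zero>" "c \<otimes> y \<in> A"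
    using assms quot_field_iff by meson
  have "(b \<otimes> c) \<otimes> (x \<oplus> y) = c \<otimes> (b \<otimes> x) \<oplus> b \<otimes> (c \<otimes> y)"
    using b assms by (simp add: m_ac r_distr A_carrier Q_carrier)
  then have "(b \<otimes> c) \<otimes> (x \<oplus> y) \<in> A" using b A_props(6,7) by simp
  moreover have "b \<otimes> c \<in> A" "b \<otimes> c \<noteq> \<zero>" using b by (simp_all add: A_mult_nonzero)
  ultimately show ?thesis using assms by (auto simp: quot_field_iff)
qed

lemma Q_inv: assumes "x \<in> Q" "x \<noteq> \<zero>" shows "inv x \<in> Q"
proof -
  obtain b where b: "b \<in> A" "b \<noteq> \<zero>" "b \<otimes> x \<in> A" using assms quot_field_iff by meson
  have "(b \<otimes> x) \<otimes> inv x = b" using b assms by (simp add: m_assoc field_inv A_carrier Q_carrier)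
  then show ?thesis
    using b assms by (auto simp: quot_field_iff field_inv A_carrier integral_iff intro!: bexI[of _ "b \<otimes> x"])
qed

lemma FI_I:
  assumes "I \<subseteq> Q" "\<And>x y. x \<in> I \<Longrightarrow> y \<in> I \<Longrightarrow> x \<oplus> y \<in> I"
    and "\<And>a x. a \<in> A \<Longrightarrow> x \<in> I \<Longrightarrow> a \<otimes> x \<in> I"
    and "d \<in> A" "d \<noteq> \<zero>" "\<And>x. x \<in> I \<Longrightarrow> d \<otimes> x \<in> A" "x \<in> I" "x \<noteq> \<zero>"
  shows "I \<in> FI"
proof -
  have neg: "\<ominus> u \<in> I" if "u \<in> I" for u
    using assms(3)[of "\<ominus> \<one>" u] that A_props(3,5) assms(1) by (auto simp: l_minus Q_carrier subset_iff)
  have "subgroup I (add_monoid L)"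
    by (rule add.subgroupI) (use assms neg in \<open>auto simp: Q_carrier subset_iff\<close>)
  then show ?thesis
    unfolding nonzero_fractional_ideals_def fractional_ideal_def using assms by blast
qed

lemma FI_D:
  assumes "I \<in> FI"
  shows "I \<subseteq> Q" "I \<subseteq> carrier L" "\<zero> \<in> I" "\<And>x y. x \<in> I \<Longrightarrow> y \<in> I \<Longrightarrow> x \<oplus> y \<in> I"
    "\<And>a x. a \<in> A \<Longrightarrow> x \<in> I \<Longrightarrow> a \<otimes> x \<in> I"
    "\<exists>d\<in>A. d \<noteq> \<zero> \<and> (\<forall>x\<in>I. d \<otimes> x \<in> A)" "\<exists>x\<in>I. x \<noteq> \<zero>"
proof -
  have I: "I \<subseteq> Q" "subgroup I (add_monoid L)" "\<forall>a\<in>A. \<forall>x\<in>I. a \<otimes> x \<in> I"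
    "\<exists>d\<in>A. d \<noteq> \<zero> \<and> (\<forall>x\<in>I. d \<otimes> x \<in> A)" "I \<noteq> {\<zero>}"
    using assms unfolding nonzero_fractional_ideals_def fractional_ideal_def by auto
  show "I \<subseteq> Q" "\<And>a x. a \<in> A \<Longrightarrow> x \<in> I \<Longrightarrow> a \<otimes> x \<in> I"
    "\<exists>d\<in>A. d \<noteq> \<zero> \<and> (\<forall>x\<in>I. d \<otimes> x \<in> A)" using I by auto
  show "I \<subseteq> carrier L" using I(1) Q_carrier by blast
  show "\<zero> \<in> I" "\<And>x y. x \<in> I \<Longrightarrow> y \<in> I \<Longrightarrow> x \<oplus> y \<in> I"
    using subgroup.one_closed[OF I(2)] subgroup.m_closed[OF I(2)] by simp_all
  then show "\<exists>x\<in>I. x \<noteq> \<zero>" using I(5) by blast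
qed

lemma FI_ideal_prod:
  assumes "I \<in> FI" "J \<in> FI"
  shows "I \<cdot> J \<in> FI"
proof -
  note I = FI_D[OF assms(1)] and J = FI_D[OF assms(2)]
  obtain d where d: "d \<in> A" "d \<noteq> \<zero>" "\<forall>x\<in>I. d \<otimes> x \<in> A" using I(6) by blast
  obtain e where e: "e \<in> A" "e \<noteq> \<zero>" "\<forall>x\<in>J. e \<otimes> x \<in> A" using J(6) by blast
  obtain x where x: "x \<in> I" "x \<noteq> \<zero>" using I(7) by blast
  obtain y where y: "y \<in> J" "y \<noteq> \<zero>" using J(7) by blast
  note carr = A_carrier I(2)[THEN subsetD] J(2)[THEN subsetD]
  have sub: "I \<cdot> J \<subseteq> Q"
    by (rule ideal_prod_subsetI) (use I J in \<open>auto intro: Q_mult Q_add\<close>)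
  show ?thesis
  proof (rule FI_I[where d = "d \<otimes> e" and x = "x \<otimes> y"])
    show "I \<cdot> J \<subseteq> Q" by fact
    show "d \<otimes> e \<in> A" "d \<otimes> e \<noteq> \<zero>" using d e by (simp_all add: A_mult_nonzero)
    show "x \<otimes> y \<in> I \<cdot> J" using x y ideal_prod.prod by metis
    show "x \<otimes> y \<noteq> \<zero>" using x y carr by (simp add: integral_iff)
    show "s \<oplus> t \<in> I \<cdot> J" if "s \<in> I \<cdot> J" "t \<in> I \<cdot> J" for s t using that by (rule ideal_prod.sum)
  next
    fix a s assume a: "a \<in> A" and s: "s \<in> I \<cdot> J"
    have "I \<cdot> J \<subseteq> {s \<in> carrier L. a \<otimes> s \<in> I \<cdot> J}"
    proof (rule ideal_prod_subsetI)
      fix i j assume ij: "i \<in> I" "j \<in> J"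
      then have "a \<otimes> (i \<otimes> j) = (a \<otimes> i) \<otimes> j" using a carr by (simp add: m_assoc)
      then show "i \<otimes> j \<in> {s \<in> carrier L. a \<otimes> s \<in> I \<cdot> J}"
        using ij a I(5) carr by (simp add: ideal_prod.prod)
    qed (use a carr in \<open>auto simp: r_distr intro: ideal_prod.sum\<close>)
    then show "a \<otimes> s \<in> I \<cdot> J" using s by blast
  next
    fix s assume s: "s \<in> I \<cdot> J"
    have "I \<cdot> J \<subseteq> {s \<in> carrier L. d \<otimes> e \<otimes> s \<in> A}"
    proof (rule ideal_prod_subsetI)
      fix i j assume ij: "i \<in> I" "j \<in> J"
      then have "d \<otimes> e \<otimes> (i \<otimes> j) = (d \<otimes> i) \<otimes> (e \<otimes> j)" using d e carr by (simp add: m_ac)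
      then show "i \<otimes> j \<in> {s \<in> carrier L. d \<otimes> e \<otimes> s \<in> A}"
        using ij d e A_props(6) carr by simp
    qed (use d e A_props(6,7) carr in \<open>auto simp: r_distr\<close>)
    then show "d \<otimes> e \<otimes> s \<in> A" using s by blast
  qed
qed

lemma principal_eq_l_coset:
  "x \<in> Q \<Longrightarrow> {a \<otimes> x | a. a \<in> A} = x <# A"
  using m_comm A_carrier Q_carrier unfolding l_coset_def by blast

lemma ideal_prod_principal:
  assumes "I \<in> FI" "x \<in> Q"
  shows "I \<cdot> (x <# A) = x <# I"
proof -
  note I = FI_D[OF assms(1)]
  have "I \<cdot> A = I"
  proof
    show "I \<cdot> A \<subseteq> I"
    proof (rule ideal_prod_subsetI)
      fix i a assume "i \<in> I" "a \<in> A"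
      then show "i \<otimes> a \<in> I" using I(2,5) m_comm[of i a] A_carrier by auto
    qed (rule I(4))
    show "I \<subseteq> I \<cdot> A"
      using ideal_prod.prod[of _ I \<one> A L] A_props(3) I(2) by force
  qed
  then show ?thesis
    using l_coset_ideal_prod[OF I(2) A_props(1) one_closed Q_carrier[OF assms(2)]] assms(2) I(2)
    by (simp add: l_coset_one Q_carrier)
qed

text \<open>
  Multiplication by a principal fractional ideal is multiplication by its generator, and generators
  are invertible; so the two principal factors in the definition can be moved to one side.
\<close>
lemma class_rel_iff:
  "(I, J) \<in> class_rel L A \<longleftrightarrow>
     I \<in> FI \<and> J \<in> FI \<and> (\<exists>c\<in>Q. c \<noteq> \<zero> \<and> I = c <# J)"
proof -
  have N: "nonzero_principal_fractional_ideals L A = (\<lambda>x. x <# A) ` (Q - {\<zero>})"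
    unfolding nonzero_principal_fractional_ideals_def using principal_eq_l_coset by auto
  have 1: "(\<exists>P\<in>nonzero_principal_fractional_ideals L A.
      \<exists>P'\<in>nonzero_principal_fractional_ideals L A. I \<cdot> P = J \<cdot> P') \<longleftrightarrow>
      (\<exists>x\<in>Q - {\<zero>}. \<exists>y\<in>Q - {\<zero>}. x <# I = y <# J)"
    if "I \<in> FI" "J \<in> FI"
    unfolding N bex_simps by (intro bex_cong refl) (simp add: ideal_prod_principal that)
  have 2: "(\<exists>x\<in>Q. \<exists>y\<in>Q. x \<noteq> \<zero> \<and> y \<noteq> \<zero> \<and> x <# I = y <# J) \<longleftrightarrow> (\<exists>c\<in>Q. c \<noteq> \<zero> \<and> I = c <# J)"
    if "I \<in> FI" "J \<in> FI"
  proof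
    assume "\<exists>x\<in>Q. \<exists>y\<in>Q. x \<noteq> \<zero> \<and> y \<noteq> \<zero> \<and> x <# I = y <# J"
    then obtain x y where xy: "x \<in> Q" "y \<in> Q" "x \<noteq> \<zero>" "y \<noteq> \<zero>" "x <# I = y <# J" by blast
    note carr = xy(1,2)[THEN Q_carrier] that[THEN FI_D(2)]
    have "I = inv x <# (x <# I)"
      using xy(3) carr by (simp add: l_coset_assoc l_coset_one field_inv)
    also have "\<dots> = (inv x \<otimes> y) <# J"
      unfolding xy(5) by (rule l_coset_assoc) (use xy carr in \<open>simp_all add: field_inv\<close>)
    finally show "\<exists>c\<in>Q. c \<noteq> \<zero> \<and> I = c <# J"
      using xy carr by (auto simp: Q_inv Q_mult field_inv integral_iff intro!: bexI[of _ "inv x \<otimes> y"])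
  next
    assume "\<exists>c\<in>Q. c \<noteq> \<zero> \<and> I = c <# J"
    then obtain c where c: "c \<in> Q" "c \<noteq> \<zero>" "I = c <# J" by blast
    moreover have "\<one> <# I = c <# J" using c(3) l_coset_one[OF FI_D(2)[OF that(1)]] by simp
    moreover have "\<one> \<in> Q" using A_in_Q A_props(3) by blast
    ultimately show "\<exists>x\<in>Q. \<exists>y\<in>Q. x \<noteq> \<zero> \<and> y \<noteq> \<zero> \<and> x <# I = y <# J"
      using one_not_zero by blast
  qed
  then show ?thesis
  proof (cases "I \<in> FI \<and> J \<in> FI")
    case True
    have "(I, J) \<in> class_rel L A \<longleftrightarrow> (\<exists>x\<in>Q - {\<zero>}. \<exists>y\<in>Q - {\<zero>}. x <# I = y <# J)"
      unfolding class_rel_def using True 1 by simp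
    also have "\<dots> \<longleftrightarrow> (\<exists>x\<in>Q. \<exists>y\<in>Q. x \<noteq> \<zero> \<and> y \<noteq> \<zero> \<and> x <# I = y <# J)" by blast
    finally show ?thesis using True 2 by simp
  next
    case False
    then show ?thesis unfolding class_rel_def by blast
  qed
qed

lemma class_rel_equiv: "equiv FI (class_rel L A)"
proof (rule equivI)
  have one: "\<one> \<in> Q" using A_in_Q A_props(3) by blast
  show "class_rel L A \<subseteq> FI \<times> FI" by (auto simp: class_rel_iff)
  show "refl_on FI (class_rel L A)"
    unfolding refl_on_def
    using one FI_D(2) l_coset_one one_not_zero by (auto simp: class_rel_iff intro!: bexI[of _ \<one>])
  show "sym (class_rel L A)"
  proof (rule symI)
    fix I J assume "(I, J) \<in> class_rel L A"
    then obtain c where c: "I \<in> FI" "J \<in> FI" "c \<in> Q" "c \<noteq> \<zero>" "I = c <# J"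
      by (auto simp: class_rel_iff)
    have "J = inv c <# I"
      using c FI_D(2)[OF c(2)] Q_carrier[OF c(3)] by (simp add: l_coset_assoc l_coset_one field_inv)
    then show "(J, I) \<in> class_rel L A"
      using c Q_inv Q_carrier field_inv(4) class_rel_iff by blast
  qed
  show "trans (class_rel L A)"
  proof (rule transI)
    fix I J H assume "(I, J) \<in> class_rel L A" "(J, H) \<in> class_rel L A"
    then obtain c d where c: "I \<in> FI" "J \<in> FI" "H \<in> FI" "c \<in> Q" "c \<noteq> \<zero>" "I = c <# J"
       "d \<in> Q" "d \<noteq> \<zero>" "J = d <# H"
      by (auto simp: class_rel_iff)
    have "I = (c \<otimes> d) <# H" using c FI_D(2) Q_carrier l_coset_assoc by metis
    moreover have "c \<otimes> d \<noteq> \<zero>" using c by (simp add: Q_carrier integral_iff)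
    ultimately show "(I, H) \<in> class_rel L A" using c Q_mult by (auto simp: class_rel_iff)
  qed
qed

lemma class_rel_ideal_prod:
  assumes "(I, I') \<in> class_rel L A" "(J, J') \<in> class_rel L A"
  shows "(I \<cdot> J, I' \<cdot> J') \<in> class_rel L A"
proof -
  obtain c d where c: "I \<in> FI" "I' \<in> FI" "J \<in> FI" "J' \<in> FI" "c \<in> Q" "c \<noteq> \<zero>" "I = c <# I'"
    "d \<in> Q" "d \<noteq> \<zero>" "J = d <# J'"
    using assms by (auto simp: class_rel_iff)
  have "I \<cdot> J = (c \<otimes> d) <# (I' \<cdot> J')"
    using c FI_D(2) Q_carrier l_coset_ideal_prod by metis
  moreover have "c \<otimes> d \<noteq> \<zero>" using c by (simp add: Q_carrier integral_iff)
  moreover have "I \<cdot> J \<in> FI" "I' \<cdot> J' \<in> FI" using c(1-4) by (simp_all add: FI_ideal_prod)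
  ultimately show ?thesis using c(5,8) Q_mult by (auto simp: class_rel_iff)
qed

abbreviation cl where "cl I \<equiv> class_rel L A `` {I}"

lemma class_eq_iff:
  assumes "I \<in> FI" "J \<in> FI"
  shows "cl I = cl J \<longleftrightarrow> (\<exists>c\<in>Q. c \<noteq> \<zero> \<and> I = c <# J)"
  using eq_equiv_class_iff[OF class_rel_equiv assms] assms by (simp add: class_rel_iff)

lemma class_mult:
  assumes "I \<in> FI" "J \<in> FI"
  shows "cl I \<otimes>\<^bsub>class_semigroup L A\<^esub> cl J = cl (I \<cdot> J)"
proof -
  have "cl (I' \<cdot> J') = cl (I \<cdot> J)" if "I' \<in> cl I" "J' \<in> cl J" for I' J'
    using that class_rel_ideal_prod equiv_class_eq[OF class_rel_equiv] by blast
  then have "(\<Union>I'\<in>cl I. \<Union>J'\<in>cl J. cl (I' \<cdot> J')) = (\<Union>I'\<in>cl I. \<Union>J'\<in>cl J. cl (I \<cdot> J))"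
    by (intro SUP_cong refl)
  also have "\<dots> = cl (I \<cdot> J)"
    using equiv_class_self[OF class_rel_equiv assms(1)] equiv_class_self[OF class_rel_equiv assms(2)]
    by (auto simp del: Image_singleton_iff)
  finally show ?thesis unfolding class_semigroup_def by simp
qed

lemma class_carrier: "carrier (class_semigroup L A) = cl ` FI"
  unfolding class_semigroup_def quotient_def by auto

text \<open>
  If \<open>d I \<subseteq> A\<close> and \<open>i \<in> I\<close> is nonzero, then \<open>i\<^sup>2 (I : I\<^sup>2) \<subseteq> I\<close>, so that \<open>d (d i)\<^sup>2\<close> is a common
  denominator of the residual.
\<close>
lemma FI_square_residual:
  assumes "I \<in> FI" "x \<in> square_residual I" "x \<noteq> \<zero>"
  shows "square_residual I \<in> FI"
proof -
  note I = FI_D[OF assms(1)]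
  obtain d where d: "d \<in> A" "d \<noteq> \<zero>" "\<forall>x\<in>I. d \<otimes> x \<in> A" using I(6) by blast
  obtain i where i: "i \<in> I" "i \<noteq> \<zero>" using I(7) by blast
  have carr: "i \<in> carrier L" "d \<in> carrier L" using i d I(2) A_carrier by auto
  let ?e = "d \<otimes> (d \<otimes> i) \<otimes> (d \<otimes> i)"
  have e: "?e \<in> A" "?e \<noteq> \<zero>"
    using d i carr by (simp_all add: A_props(6) integral_iff)
  have ex: "?e \<otimes> x \<in> A" if "x \<in> square_residual I" for x
  proof -
    have x: "x \<in> carrier L" "i \<otimes> i \<otimes> x \<in> I" using that i unfolding square_residual_def by auto
    have "?e \<otimes> x = (d \<otimes> d) \<otimes> (d \<otimes> (i \<otimes> i \<otimes> x))" using x carr by (simp add: m_ac)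
    then show ?thesis using d x A_props(6) by simp
  qed
  show ?thesis
  proof (rule FI_I[where d = ?e and x = x])
    show "square_residual I \<subseteq> Q"
    proof
      fix x assume "x \<in> square_residual I"
      then show "x \<in> Q"
        using ex e unfolding quot_field_iff by (auto simp: square_residual_def)
    qed
    show "?e \<in> A" "?e \<noteq> \<zero>" by fact+
  next
    fix u v assume "u \<in> square_residual I" "v \<in> square_residual I"
    then show "u \<oplus> v \<in> square_residual I"
      using I(2,4) by (auto simp: square_residual_def r_distr subset_iff)
  next
    fix a u assume a: "a \<in> A" and u: "u \<in> square_residual I"
    have "i \<otimes> j \<otimes> (a \<otimes> u) \<in> I" if "i \<in> I" "j \<in> I" for i j
    proof -
      have "i \<otimes> j \<otimes> (a \<otimes> u) = a \<otimes> (i \<otimes> j \<otimes> u)"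
        using that a u I(2) A_carrier by (simp add: square_residual_def m_ac subset_iff)
      then show ?thesis using that a u I(5) unfolding square_residual_def by simp
    qed
    then show "a \<otimes> u \<in> square_residual I" using a u A_carrier by (simp add: square_residual_def)
  qed (use ex assms in auto)
qed

text \<open>
  A class \<open>a\<close> as in the definition is represented by some \<open>J\<close> with \<open>I\<^sup>2 J = c I\<close>. Then
  \<open>c\<^sup>-\<^sup>1 J\<close> lies in the residual \<open>(I : I\<^sup>2)\<close>, so the residual is a witness whenever there is one.
\<close>
lemma clifford_regular_iff:
  "clifford_regular L A \<longleftrightarrow> (\<forall>I\<in>FI. clifford_ideal I)"
proof -
  have "(\<exists>J\<in>FI. cl (I \<cdot> I \<cdot> J) = cl I) \<longleftrightarrow> clifford_ideal I" if I: "I \<in> FI" for I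
  proof
    assume "\<exists>J\<in>FI. cl (I \<cdot> I \<cdot> J) = cl I"
    then obtain J c where J: "J \<in> FI" and c: "c \<in> Q" "c \<noteq> \<zero>" and eq: "I \<cdot> I \<cdot> J = c <# I"
      using class_eq_iff FI_ideal_prod I by metis
    note carr = Q_carrier[OF c(1)] FI_D(2)[OF I, THEN subsetD] FI_D(2)[OF J, THEN subsetD]
    have res: "inv c \<otimes> j \<in> square_residual I" if j: "j \<in> J" for j
    proof -
      have "i \<otimes> i' \<otimes> (inv c \<otimes> j) \<in> I" if i: "i \<in> I" "i' \<in> I" for i i'
      proof -
        have "i \<otimes> i' \<otimes> j \<in> c <# I" using i j eq by (metis ideal_prod.prod)
        then have "inv c \<otimes> (i \<otimes> i' \<otimes> j) \<in> I"
          using mem_l_coset_iff c carr i j FI_D(2)[OF I] by simp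
        then show ?thesis using c carr i j by (simp add: m_ac field_inv)
      qed
      then show ?thesis using c carr j by (simp add: square_residual_def field_inv)
    qed
    have "I \<cdot> I \<cdot> J \<subseteq> {s \<in> carrier L. inv c \<otimes> s \<in> I \<cdot> I \<cdot> square_residual I}"
    proof (rule ideal_prod3_subsetI)
      fix i i' j assume i: "i \<in> I" "i' \<in> I" "j \<in> J"
      then have "inv c \<otimes> (i \<otimes> i' \<otimes> j) = i \<otimes> i' \<otimes> (inv c \<otimes> j)"
        using c carr by (simp add: m_ac field_inv)
      then show "i \<otimes> i' \<otimes> j \<in> {s \<in> carrier L. inv c \<otimes> s \<in> I \<cdot> I \<cdot> square_residual I}"
        using i carr res by (simp add: ideal_prod.prod)
    qed (use c carr in \<open>auto simp: field_inv r_distr intro: ideal_prod.sum\<close>)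
    then show "clifford_ideal I"
      unfolding clifford_ideal_def eq l_coset_def using c carr by (auto simp: inv_cancel)
  next
    assume cl: "clifford_ideal I"
    note ID = FI_D[OF I]
    have "\<exists>x\<in>square_residual I. x \<noteq> \<zero>"
      using ID(2,7) clifford_ideal_residual_nonzero[OF cl] by blast
    then have S: "square_residual I \<in> FI" using FI_square_residual I by blast
    have "I \<cdot> I \<cdot> square_residual I \<subseteq> I"
      by (rule ideal_prod3_subsetI) (use ID in \<open>auto simp: square_residual_def\<close>)
    then have "I \<cdot> I \<cdot> square_residual I = I" using cl unfolding clifford_ideal_def by blast
    then show "\<exists>J\<in>FI. cl (I \<cdot> I \<cdot> J) = cl I" using S by metis
  qed
  then show ?thesis
    unfolding clifford_regular_def clifford_semigroup_def class_carrier
    by (simp add: class_mult FI_ideal_prod)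
qed

lemma boole_regular_iff:
  "boole_regular L A \<longleftrightarrow> (\<forall>I\<in>FI. \<exists>c\<in>Q. c \<noteq> \<zero> \<and> I \<cdot> I = c <# I)"
proof -
  have "boole_regular L A \<longleftrightarrow> (\<forall>I\<in>FI. cl (I \<cdot> I) = cl I)"
    unfolding boole_regular_def boolean_semigroup_def class_carrier
    by (auto simp: class_mult)
  then show ?thesis by (simp add: class_eq_iff FI_ideal_prod)
qed

lemma boole_imp_clifford: "boole_regular L A \<Longrightarrow> clifford_regular L A"
  unfolding boole_regular_def boolean_semigroup_def clifford_regular_def clifford_semigroup_def
  by metis

end

section \<open>Overrings and fields\<close>

context domain_in_field
begin

lemma quot_field_subfield: "subfield Q L"
proof (rule subfieldI')
  show "subring Q L"
  proof (rule subringI)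
    show "Q \<subseteq> carrier L" using Q_carrier by blast
    show "\<one> \<in> Q" using A_in_Q A_props(3) by blast
    show "\<ominus> x \<in> Q" if "x \<in> Q" for x
      using Q_mult[of "\<ominus> \<one>" x] that A_in_Q A_props(3,5) by (auto simp: l_minus Q_carrier)
  qed (auto intro: Q_mult Q_add)
qed (auto intro: Q_inv)

text \<open>
  A nonzero \<open>m\<close> with \<open>m B \<subseteq> A\<close> turns denominators over \<open>B\<close> into denominators over \<open>A\<close>, so the fractional
  ideals of \<open>B\<close> are exactly those of \<open>A\<close> that are closed under multiplication by \<open>B\<close>.
\<close>
lemma overring_with_conductor:
  assumes B: "subring B L" and AB: "A \<subseteq> B"
    and m: "m \<in> A" "m \<noteq> \<zero>" "\<forall>t\<in>B. m \<otimes> t \<in> A"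
  shows "quot_field L B = Q"
    and "nonzero_fractional_ideals L B \<subseteq> FI"
    and "\<And>I. I \<in> FI \<Longrightarrow> (\<And>t i. t \<in> B \<Longrightarrow> i \<in> I \<Longrightarrow> t \<otimes> i \<in> I) \<Longrightarrow>
      I \<in> nonzero_fractional_ideals L B"
proof -
  interpret B: domain_in_field L B
    by (rule domain_in_field.intro[OF field_axioms domain_in_field_axioms.intro[OF B]])
  have mc: "m \<in> carrier L" using m A_carrier by blast
  show eq: "quot_field L B = Q"
  proof
    show "B.Q \<subseteq> Q"
    proof
      fix x assume "x \<in> B.Q"
      then obtain b where b: "x \<in> carrier L" "b \<in> B" "b \<noteq> \<zero>" "b \<otimes> x \<in> B"
        using B.quot_field_iff by blast
      have "(m \<otimes> b) \<otimes> x \<in> A" using bspec[OF m(3) b(4)] mc b B.A_carrier by (simp add: m_assoc)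
      moreover have "m \<otimes> b \<noteq> \<zero>" using b m(2) mc B.A_carrier by (simp add: integral_iff)
      ultimately show "x \<in> Q" using quot_field_iff b(1) bspec[OF m(3) b(2)] by blast
    qed
    show "Q \<subseteq> B.Q" using quot_field_iff B.quot_field_iff AB by blast
  qed
  show "B.FI \<subseteq> FI"
  proof
    fix I assume I: "I \<in> B.FI"
    note ID = B.FI_D[OF I]
    obtain d where d: "d \<in> B" "d \<noteq> \<zero>" "\<forall>x\<in>I. d \<otimes> x \<in> B" using ID(6) by blast
    obtain x where x: "x \<in> I" "x \<noteq> \<zero>" using ID(7) by blast
    show "I \<in> FI"
    proof (rule FI_I[where d = "m \<otimes> d" and x = x])
      show "m \<otimes> d \<in> A" using bspec[OF m(3) d(1)] .
      show "m \<otimes> d \<noteq> \<zero>" using d m(2) mc B.A_carrier by (simp add: integral_iff)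
      show "m \<otimes> d \<otimes> x \<in> A" if "x \<in> I" for x
        using bspec[OF m(3), of "d \<otimes> x"] d that mc B.A_carrier ID(2) by (simp add: m_assoc subset_iff)
    qed (use ID x eq AB in auto)
  qed
  fix I assume I: "I \<in> FI" and cl: "\<And>t i. t \<in> B \<Longrightarrow> i \<in> I \<Longrightarrow> t \<otimes> i \<in> I"
  note ID = FI_D[OF I]
  obtain d where d: "d \<in> A" "d \<noteq> \<zero>" "\<forall>x\<in>I. d \<otimes> x \<in> A" using ID(6) by blast
  obtain x where x: "x \<in> I" "x \<noteq> \<zero>" using ID(7) by blast
  show "I \<in> B.FI"
    by (rule B.FI_I[where d = d and x = x]) (use ID(1,4) d x AB cl eq in auto)
qed

lemma boole_regular_field:
  assumes inv: "\<And>a. a \<in> A \<Longrightarrow> a \<noteq> \<zero> \<Longrightarrow> inv a \<in> A"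
  shows "boole_regular L A"
  unfolding boole_regular_iff
proof
  fix I assume I: "I \<in> FI"
  note ID = FI_D[OF I]
  have QA: "Q \<subseteq> A"
  proof
    fix x assume "x \<in> Q"
    then obtain b where b: "x \<in> carrier L" "b \<in> A" "b \<noteq> \<zero>" "b \<otimes> x \<in> A"
      using quot_field_iff by blast
    then have "inv b \<otimes> (b \<otimes> x) \<in> A" using inv A_props(6) by blast
    then show "x \<in> A" using b A_carrier by (simp add: inv_cancel)
  qed
  obtain x where x: "x \<in> I" "x \<noteq> \<zero>" using ID(7) by blast
  have xA: "x \<in> A" using x ID(1) QA by blast
  have "inv x \<otimes> x \<in> I" using ID(5)[OF inv[OF xA x(2)] x(1)] .
  then have one: "\<one> \<in> I" using x(2) xA A_carrier by (simp add: field_inv)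
  have "A \<subseteq> I"
  proof
    fix a assume "a \<in> A"
    then show "a \<in> I" using ID(5)[OF _ one] A_carrier[of a] by fastforce
  qed
  then have IA: "I = A" using ID(1) QA by blast
  have oneQ: "\<one> \<in> Q" using A_in_Q A_props(3) by blast
  have "I \<cdot> I = \<one> <# I"
    using ideal_prod_principal[OF I oneQ] l_coset_one[OF A_props(1)] unfolding IA by simp
  then show "\<exists>c\<in>Q. c \<noteq> \<zero> \<and> I \<cdot> I = c <# I" using oneQ one_not_zero by blast
qed

end

section \<open>Valuation domains\<close>

lemma ideal_prod_carrier_update:
  "I \<cdot>\<^bsub>L\<lparr>carrier := A\<rparr>\<^esub> J = I \<cdot>\<^bsub>L\<^esub> J"
proof
  show "I \<cdot>\<^bsub>L\<lparr>carrier := A\<rparr>\<^esub> J \<subseteq> I \<cdot>\<^bsub>L\<^esub> J"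
  proof
    fix s assume "s \<in> I \<cdot>\<^bsub>L\<lparr>carrier := A\<rparr>\<^esub> J"
    then show "s \<in> I \<cdot>\<^bsub>L\<^esub> J" by induct (auto intro: ideal_prod.intros)
  qed
  show "I \<cdot>\<^bsub>L\<^esub> J \<subseteq> I \<cdot>\<^bsub>L\<lparr>carrier := A\<rparr>\<^esub> J"
  proof
    fix s assume "s \<in> I \<cdot>\<^bsub>L\<^esub> J"
    then show "s \<in> I \<cdot>\<^bsub>L\<lparr>carrier := A\<rparr>\<^esub> J"
      using ideal_prod.prod[of _ I _ J "L\<lparr>carrier := A\<rparr>"]
        ideal_prod.sum[where R = "L\<lparr>carrier := A\<rparr>" and I = I and J = J]
      by induct simp_all
  qed
qed

context domain_in_field
begin

lemma valuation_total:
  assumes "valuation_domain L A" "x \<in> Q" "y \<in> Q" "x \<noteq> \<zero>" "inv x \<otimes> y \<notin> A"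
  shows "y \<noteq> \<zero>" "inv y \<otimes> x \<in> A"
proof -
  have c: "x \<in> carrier L" "y \<in> carrier L" using assms Q_carrier by auto
  show y: "y \<noteq> \<zero>" using assms(4,5) c A_props(2) field_inv by auto
  have "inv x \<otimes> y \<in> Q" "inv x \<otimes> y \<noteq> \<zero>"
    using assms c y by (simp_all add: Q_mult Q_inv integral_iff field_inv)
  then have "inv (inv x \<otimes> y) \<in> A" using assms(1,5) unfolding valuation_domain_def by blast
  moreover have "(inv x \<otimes> y) \<otimes> (inv y \<otimes> x) = (inv x \<otimes> x) \<otimes> (y \<otimes> inv y)"
    using c y assms(4) field_inv(1) by (simp add: m_ac)
  then have "(inv x \<otimes> y) \<otimes> (inv y \<otimes> x) = \<one>" using c y assms(4) by (simp add: field_inv)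
  then have "inv (inv x \<otimes> y) = inv y \<otimes> x"
    using comm_inv_char[of "inv x \<otimes> y" "inv y \<otimes> x"] c y assms(4) field_inv(1) by simp
  ultimately show "inv y \<otimes> x \<in> A" by simp
qed

text \<open>
  The hypothesis says that \<open>I\<close> is not generated over \<open>(I : I)\<close> by any single element \<open>x\<close>. Then some
  \<open>u = x\<^sup>-\<^sup>1 y z\<close> with \<open>y, z \<in> I\<close> lies outside \<open>I\<close>, and since the ideals of a valuation domain
  form a chain, \<open>I \<subseteq> u A\<close>. Hence \<open>u\<^sup>-\<^sup>1 I\<^sup>2 \<subseteq> A I \<subseteq> I\<close>, and \<open>x = y z u\<^sup>-\<^sup>1\<close> lies in
  \<open>I\<^sup>2 (I : I\<^sup>2)\<close>.
\<close>
lemma valuation_clifford_ideal_of_not_principal: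
  assumes val: "valuation_domain L A" and I: "I \<in> FI"
    and ndiv: "\<And>x. x \<in> I \<Longrightarrow> x \<noteq> \<zero> \<Longrightarrow> \<exists>y\<in>I. \<exists>z\<in>I. inv x \<otimes> y \<otimes> z \<notin> I"
  shows "clifford_ideal I"
  unfolding clifford_ideal_def
proof
  fix x assume x: "x \<in> I"
  note ID = FI_D[OF I]
  note carr = ID(2)[THEN subsetD]
  show "x \<in> I \<cdot> I \<cdot> square_residual I"
  proof (cases "x = \<zero>")
    case True
    have "\<zero> \<in> square_residual I" unfolding square_residual_def using carr ID(3) by simp
    then have "\<zero> \<otimes> \<zero> \<otimes> \<zero> \<in> I \<cdot> I \<cdot> square_residual I" using ID(3) by (blast intro: ideal_prod.prod)
    then show ?thesis using True by simp
  next
    case False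
    obtain y z where yz: "y \<in> I" "z \<in> I" "inv x \<otimes> y \<otimes> z \<notin> I" using ndiv[OF x False] by blast
    define u where "u = inv x \<otimes> y \<otimes> z"
    have c: "x \<in> carrier L" "y \<in> carrier L" "z \<in> carrier L" "inv x \<in> carrier L"
      using carr x yz False field_inv(1) by auto
    have uQ: "u \<in> Q" unfolding u_def
      by (intro Q_mult Q_inv subsetD[OF ID(1)] x yz(1,2) False)
    have u0: "u \<noteq> \<zero>" using yz(3) ID(3) unfolding u_def by auto
    have uc: "u \<in> carrier L" using uQ Q_carrier by blast
    have div: "inv u \<otimes> i \<in> A" if i: "i \<in> I" for i
    proof (rule ccontr)
      assume "inv u \<otimes> i \<notin> A"
      then have "i \<noteq> \<zero>" "inv i \<otimes> u \<in> A"
        using valuation_total[OF val uQ subsetD[OF ID(1) i] u0] by blast+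
      then have "(inv i \<otimes> u) \<otimes> i \<in> I" using ID(5)[OF _ i] by blast
      moreover have "(inv i \<otimes> u) \<otimes> i = (inv i \<otimes> i) \<otimes> u"
        using carr[OF i] \<open>i \<noteq> \<zero>\<close> uc field_inv(1) by (simp add: m_ac)
      moreover have "\<dots> = u" using carr[OF i] \<open>i \<noteq> \<zero>\<close> uc by (simp add: field_inv)
      ultimately show False using yz(3) u_def by simp
    qed
    have "inv u \<in> square_residual I"
    proof -
      have "i \<otimes> j \<otimes> inv u \<in> I" if ij: "i \<in> I" "j \<in> I" for i j
      proof -
        have "i \<otimes> j \<otimes> inv u = (inv u \<otimes> i) \<otimes> j"
          using ij carr field_inv(1)[OF uc u0] by (simp add: m_ac)
        then show ?thesis using div ij ID(5) by simp
      qed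
      then show ?thesis unfolding square_residual_def using field_inv(1)[OF uc u0] by blast
    qed
    then have "y \<otimes> z \<otimes> inv u \<in> I \<cdot> I \<cdot> square_residual I"
      using yz by (blast intro: ideal_prod.prod)
    moreover have "x \<otimes> u = (x \<otimes> inv x) \<otimes> (y \<otimes> z)"
      unfolding u_def using c by (simp add: m_ac)
    then have "y \<otimes> z = x \<otimes> u" using c False by (simp add: field_inv)
    then have "y \<otimes> z \<otimes> inv u = x" using c(1) uc u0 by (simp add: m_assoc field_inv)
    ultimately show ?thesis by simp
  qed
qed

lemma valuation_imp_clifford_ideal:
  assumes val: "valuation_domain L A" and I: "I \<in> FI"
  shows "clifford_ideal I"
proof (cases "\<exists>x\<in>I. x \<noteq> \<zero> \<and> (\<forall>y\<in>I. \<forall>z\<in>I. inv x \<otimes> y \<otimes> z \<in> I)")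
  case True
  then obtain x where x: "x \<in> I" "x \<noteq> \<zero>" "\<And>y z. y \<in> I \<Longrightarrow> z \<in> I \<Longrightarrow> inv x \<otimes> y \<otimes> z \<in> I" by blast
  have "I \<cdot> I = x <# I"
    using square_of_principal_over_multipliers[OF FI_D(2,4)[OF I] x] .
  then show ?thesis
    using square_similar_imp_clifford_ideal FI_D(2)[OF I] x by blast
next
  case False
  then show ?thesis using valuation_clifford_ideal_of_not_principal[OF val I] by blast
qed

text \<open>
  For a valuation domain \<open>A\<close>, the ring \<open>(I : I)\<close> is an overring of \<open>A\<close> and again a valuation domain.
  Its nonunits all lie in \<open>A\<close>, because the inverse of an element outside \<open>A\<close> is in \<open>A\<close> and hence in
  \<open>(I : I)\<close>. So the following subset of \<open>A\<close> is the maximal ideal of \<open>(I : I)\<close>.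
\<close>
definition multiplier_nonunits :: "'a set \<Rightarrow> 'a set" where
  "multiplier_nonunits I = {p \<in> A. p = \<zero> \<or> (\<exists>i\<in>I. inv p \<otimes> i \<notin> I)}"

text \<open>
  Everything reduces to absorption. For sums, one of \<open>p, q\<close> divides the other, and
  \<open>p + q = (1 + p\<^sup>-\<^sup>1 q) p\<close> is a multiple of \<open>p\<close>; primeness holds as a product of units of
  \<open>(I : I)\<close> is a unit.
\<close>
lemma primeideal_multiplier_nonunits:
  assumes val: "valuation_domain L A" and I: "I \<in> FI"
  shows "primeideal (multiplier_nonunits I) (L\<lparr>carrier := A\<rparr>)"
proof -
  note ID = FI_D[OF I]
  note carr = ID(2)[THEN subsetD]
  let ?P = "multiplier_nonunits I"
  let ?A = "L\<lparr>carrier := A\<rparr>"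
  interpret A: cring ?A by (rule A_cring)
  have zero: "\<zero> \<in> ?P" unfolding multiplier_nonunits_def using A_props(2) by simp
  have PA: "p \<in> A" if "p \<in> ?P" for p using that unfolding multiplier_nonunits_def by blast
  \<comment> \<open>If \<open>a p\<close> were a unit of \<open>(I : I)\<close>, then \<open>p\<^sup>-\<^sup>1 = a (a p)\<^sup>-\<^sup>1\<close> would multiply \<open>I\<close> into itself.\<close>
  have absorb: "a \<otimes> p \<in> ?P" if a: "a \<in> A" and p: "p \<in> ?P" for a p
  proof (rule ccontr)
    assume n: "a \<otimes> p \<notin> ?P"
    have c: "a \<in> carrier L" "p \<in> carrier L" using a PA[OF p] A_carrier by auto
    have ap: "a \<otimes> p \<noteq> \<zero>" "\<And>i. i \<in> I \<Longrightarrow> inv (a \<otimes> p) \<otimes> i \<in> I"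
      using n a PA[OF p] A_props(6) unfolding multiplier_nonunits_def by auto
    have nz: "a \<noteq> \<zero>" "p \<noteq> \<zero>" using ap(1) c by auto
    have "inv p \<otimes> i \<in> I" if i: "i \<in> I" for i
    proof -
      have "a \<otimes> (inv (a \<otimes> p) \<otimes> i) = (a \<otimes> inv a) \<otimes> (inv p \<otimes> i)"
        using c nz carr[OF i] by (simp add: inv_mult field_inv(1) m_ac)
      also have "\<dots> = inv p \<otimes> i" using c nz carr[OF i] by (simp add: field_inv)
      finally show ?thesis using ID(5)[OF a ap(2)[OF i]] by simp
    qed
    then show False using p nz unfolding multiplier_nonunits_def by blast
  qed
  have add: "p \<oplus> q \<in> ?P" if pq: "p \<in> ?P" "q \<in> ?P" for p q
  proof -
    have one: "p \<oplus> q \<in> ?P" if pq: "p \<in> ?P" "q \<in> ?P" "p \<noteq> \<zero>" "inv p \<otimes> q \<in> A" for p q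
    proof -
      have c: "p \<in> carrier L" "q \<in> carrier L" using pq PA A_carrier by auto
      have "p \<oplus> q = (\<one> \<oplus> inv p \<otimes> q) \<otimes> p"
      proof -
        have "(\<one> \<oplus> inv p \<otimes> q) \<otimes> p = p \<oplus> (inv p \<otimes> p) \<otimes> q"
          using c pq(3) field_inv(1) by (simp add: r_distr l_distr m_ac)
        then show ?thesis using c pq(3) by (simp add: field_inv)
      qed
      then show ?thesis using absorb[of "\<one> \<oplus> inv p \<otimes> q" p] pq A_props(3,7) by simp
    qed
    have c: "p \<in> carrier L" "q \<in> carrier L" using pq PA A_carrier by auto
    show ?thesis
    proof (cases "p = \<zero>")
      case True
      then show ?thesis using pq c by simp
    next
      case False
      have Q: "p \<in> Q" "q \<in> Q" using subsetD[OF A_in_Q PA] pq by simp_all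
      show ?thesis
      proof (cases "inv p \<otimes> q \<in> A")
        case True
        then show ?thesis using one[OF pq False] by blast
      next
        case F2: False
        have "q \<oplus> p \<in> ?P"
          using one[OF pq(2,1) valuation_total[OF val Q False F2]] .
        then show ?thesis using c by (simp add: a_comm)
      qed
    qed
  qed
  have "ideal ?P ?A"
  proof (rule idealI)
    show "ring ?A" by (rule A.ring_axioms)
    show "subgroup ?P (add_monoid ?A)"
    proof (rule A.add.subgroupI)
      fix p assume p: "p \<in> ?P"
      have "\<ominus>\<^bsub>?A\<^esub> p = (\<ominus>\<^bsub>?A\<^esub> \<one>\<^bsub>?A\<^esub>) \<otimes>\<^bsub>?A\<^esub> p"
        using A.l_minus[of "\<one>\<^bsub>?A\<^esub>" p] PA[OF p] A.one_closed A.l_one by simp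
      moreover have "\<ominus>\<^bsub>?A\<^esub> \<one>\<^bsub>?A\<^esub> \<in> A" using A.a_inv_closed[OF A.one_closed] by simp
      ultimately show "\<ominus>\<^bsub>?A\<^esub> p \<in> ?P" using absorb p by simp
    qed (use zero PA add in auto)
  next
    fix a x assume a: "a \<in> ?P" and x: "x \<in> carrier ?A"
    then show "x \<otimes>\<^bsub>?A\<^esub> a \<in> ?P" using absorb by simp
    then show "a \<otimes>\<^bsub>?A\<^esub> x \<in> ?P" using a x m_comm[of a x] PA A_carrier by simp
  qed
  moreover have "\<one> \<notin> ?P"
    using carr comm_inv_char[of \<one> \<one>] unfolding multiplier_nonunits_def by simp
  then have "carrier ?A \<noteq> ?P" using A_props(3) by auto
  moreover have "p \<in> ?P \<or> q \<in> ?P"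
    if "p \<in> carrier ?A" "q \<in> carrier ?A" "p \<otimes>\<^bsub>?A\<^esub> q \<in> ?P" for p q
  proof (rule ccontr)
    assume "\<not> (p \<in> ?P \<or> q \<in> ?P)"
    then have p: "p \<noteq> \<zero>" "\<And>i. i \<in> I \<Longrightarrow> inv p \<otimes> i \<in> I" and q: "q \<noteq> \<zero>" "\<And>i. i \<in> I \<Longrightarrow> inv q \<otimes> i \<in> I"
      using that(1,2) unfolding multiplier_nonunits_def by auto
    have c: "p \<in> carrier L" "q \<in> carrier L" using that A_carrier by auto
    have "inv (p \<otimes> q) \<otimes> i \<in> I" if i: "i \<in> I" for i
    proof -
      have "inv (p \<otimes> q) \<otimes> i = inv p \<otimes> (inv q \<otimes> i)"
        using c p(1) q(1) carr[OF i] by (simp add: inv_mult field_inv(1) m_assoc)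
      then show ?thesis using p(2) q(2) i by simp
    qed
    moreover have "p \<otimes> q \<noteq> \<zero>" using c p q by (simp add: integral_iff)
    ultimately show False using that(3) unfolding multiplier_nonunits_def by auto
  qed
  ultimately show ?thesis using A.is_cring by (intro primeidealI) auto
qed

text \<open>
  If \<open>I\<close> is not generated by one element over \<open>V = (I : I)\<close>, then \<open>I = P I\<close> for the maximal ideal \<open>P\<close> of
  \<open>V\<close>: for each nonzero \<open>x \<in> I\<close> there is \<open>y \<in> I\<close> with \<open>x\<^sup>-\<^sup>1 y \<notin> V\<close>, so \<open>x = (y\<^sup>-\<^sup>1 x) y \<in> P I\<close>. The ideal \<open>P\<close> is a
  nonzero prime ideal of \<open>A\<close>, hence not idempotent, and an element \<open>p\<close> of \<open>P\<close> outside \<open>P\<^sup>2\<close> generates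
  \<open>P\<close> over \<open>V\<close>. Then \<open>I = p I\<close>, so \<open>p\<^sup>-\<^sup>1 \<in> V\<close>, which contradicts \<open>p \<in> P\<close>.
\<close>
lemma strongly_discrete_valuation_square:
  assumes val: "valuation_domain L A" and sd: "strongly_discrete (L\<lparr>carrier := A\<rparr>)"
    and I: "I \<in> FI"
  shows "\<exists>c\<in>Q. c \<noteq> \<zero> \<and> I \<cdot> I = c <# I"
proof (cases "\<exists>x\<in>I. x \<noteq> \<zero> \<and> (\<forall>y\<in>I. \<forall>z\<in>I. inv x \<otimes> y \<otimes> z \<in> I)")
  case True
  then obtain x where x: "x \<in> I" "x \<noteq> \<zero>" "\<And>y z. y \<in> I \<Longrightarrow> z \<in> I \<Longrightarrow> inv x \<otimes> y \<otimes> z \<in> I" by blast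
  have "I \<cdot> I = x <# I"
    using square_of_principal_over_multipliers[OF FI_D(2,4)[OF I] x] .
  then show ?thesis using FI_D(1)[OF I] x by blast
next
  case False
  note ID = FI_D[OF I]
  note carr = ID(2)[THEN subsetD]
  let ?P = "multiplier_nonunits I"
  \<comment> \<open>The inverse of an element outside \<open>(I : I)\<close> is a nonunit of \<open>(I : I)\<close>.\<close>
  have inv_nonunit: "inv u \<in> ?P"
    if u: "u \<in> Q" "i \<in> I" "u \<otimes> i \<notin> I" for u i
  proof -
    have u0: "u \<noteq> \<zero>" using u(2,3) ID(3) carr by auto
    have uc: "u \<in> carrier L" using u Q_carrier by blast
    have "u \<notin> A" using u ID(5) by blast
    then have "inv u \<in> A" using val u u0 unfolding valuation_domain_def by blast
    moreover have "inv (inv u) = u"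
      using comm_inv_char[of "inv u" u] uc u0 by (simp add: field_inv)
    ultimately show ?thesis unfolding multiplier_nonunits_def using u by auto
  qed
  have step: "\<exists>y\<in>I. y \<noteq> \<zero> \<and> inv y \<otimes> x \<in> ?P \<and> inv y \<otimes> x \<noteq> \<zero>" if x: "x \<in> I" "x \<noteq> \<zero>" for x
  proof -
    obtain y z where yz: "y \<in> I" "z \<in> I" "inv x \<otimes> y \<otimes> z \<notin> I" using False x by blast
    have c: "x \<in> carrier L" "y \<in> carrier L" "inv x \<in> carrier L" "inv x \<noteq> \<zero>"
      using carr x yz field_inv by auto
    have y0: "y \<noteq> \<zero>"
    proof
      assume "y = \<zero>"
      then show False using yz(3) c carr[OF yz(2)] ID(3) by simp
    qed
    have "inv x \<otimes> y \<in> Q" by (intro Q_mult Q_inv subsetD[OF ID(1)] x yz(1))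
    then have "inv (inv x \<otimes> y) \<in> ?P" using inv_nonunit yz(2,3) by blast
    moreover have "inv (inv x) = x" using comm_inv_char[of "inv x" x] c x by (simp add: field_inv)
    then have "inv (inv x \<otimes> y) = inv y \<otimes> x"
      using c y0 m_comm[of x "inv y"] by (simp add: inv_mult field_inv)
    moreover have "inv y \<otimes> x \<noteq> \<zero>" using c x y0 by (simp add: integral_iff field_inv)
    ultimately show ?thesis using yz(1) y0 by auto
  qed
  obtain x0 where x0: "x0 \<in> I" "x0 \<noteq> \<zero>" using ID(7) by blast
  have "?P \<noteq> {\<zero>}" using step[OF x0] by blast
  then have "?P \<cdot> ?P \<noteq> ?P"
    using sd primeideal_multiplier_nonunits[OF val I]
    unfolding strongly_discrete_def by (auto simp: ideal_prod_carrier_update)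
  have PA: "p \<in> A" if "p \<in> ?P" for p using that unfolding multiplier_nonunits_def by blast
  have zero: "\<zero> \<in> ?P" unfolding multiplier_nonunits_def using A_props(2) by simp
  have "?P \<cdot> ?P \<subseteq> ?P"
  proof -
    interpret P: primeideal ?P "L\<lparr>carrier := A\<rparr>" by (rule primeideal_multiplier_nonunits[OF val I])
    show ?thesis
      by (rule ideal_prod_subsetI) (use P.I_l_closed PA additive_subgroup.a_closed[OF P.is_additive_subgroup] in auto)
  qed
  then obtain p where p: "p \<in> ?P" "p \<notin> ?P \<cdot> ?P" using \<open>?P \<cdot> ?P \<noteq> ?P\<close> by blast
  have pc: "p \<in> carrier L" using p PA A_carrier by blast
  have p0: "p \<noteq> \<zero>" using p(2) ideal_prod.prod[of \<zero> ?P \<zero> ?P L] zero by auto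
  have pQ: "inv p \<in> Q" by (intro Q_inv subsetD[OF A_in_Q] PA p(1) p0)
  \<comment> \<open>\<open>P \<subseteq> p V\<close>: if \<open>p\<^sup>-\<^sup>1 q \<notin> V\<close>, then \<open>p q\<^sup>-\<^sup>1 \<in> P\<close>, and \<open>p = q (p q\<^sup>-\<^sup>1)\<close> would lie in \<open>P\<^sup>2\<close>.\<close>
  have gen: "inv p \<otimes> q \<otimes> i \<in> I" if q: "q \<in> ?P" and i: "i \<in> I" for q i
  proof (rule ccontr)
    assume n: "inv p \<otimes> q \<otimes> i \<notin> I"
    have qc: "q \<in> carrier L" using q PA A_carrier by blast
    have q0: "q \<noteq> \<zero>"
    proof
      assume "q = \<zero>"
      then show False using n pc p0 carr[OF i] ID(3) by (simp add: field_inv)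
    qed
    have "inv p \<otimes> q \<in> Q" by (intro Q_mult pQ subsetD[OF A_in_Q] PA q)
    then have 1: "inv (inv p \<otimes> q) \<in> ?P" using inv_nonunit i n by blast
    have "inv (inv p) = p" using comm_inv_char[of "inv p" p] pc p0 by (simp add: field_inv)
    then have "inv (inv p \<otimes> q) = p \<otimes> inv q" using pc p0 qc q0 by (simp add: inv_mult field_inv)
    then have "q \<otimes> (p \<otimes> inv q) \<in> ?P \<cdot> ?P" using 1 q by (metis ideal_prod.prod)
    moreover have "q \<otimes> (p \<otimes> inv q) = p"
      using pc qc q0 by (simp add: m_lcomm[of q] field_inv)
    ultimately show False using p(2) by simp
  qed
  have "inv p \<otimes> x \<in> I" if x: "x \<in> I" for x
  proof (cases "x = \<zero>")
    case True
    then show ?thesis using ID(3) pc p0 by (simp add: field_inv)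
  next
    case False
    obtain y where y: "y \<in> I" "y \<noteq> \<zero>" "inv y \<otimes> x \<in> ?P" using step[OF x False] by blast
    have c: "y \<in> carrier L" "x \<in> carrier L" using carr x y by auto
    have "inv p \<otimes> (inv y \<otimes> x) \<otimes> y = (inv y \<otimes> y) \<otimes> (inv p \<otimes> x)"
      using c y(2) pc p0 field_inv(1) by (simp add: m_ac)
    also have "\<dots> = inv p \<otimes> x" using c y(2) pc p0 by (simp add: field_inv)
    finally show ?thesis using gen[OF y(3,1)] by simp
  qed
  then show ?thesis using p(1) p0 unfolding multiplier_nonunits_def by blast
qed

end

section \<open>Subspaces of a field extension and degree two\<close>

context field
begin

lemma line_extension_eq:
  assumes "E \<subseteq> carrier R" "k \<subseteq> carrier R" "z \<in> carrier R"
  shows "line_extension k z E = {a \<oplus> b \<otimes> z | a b. a \<in> E \<and> b \<in> k}"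
proof -
  have "b \<otimes> z \<oplus> a = a \<oplus> b \<otimes> z" if "a \<in> E" "b \<in> k" for a b
    using that assms by (simp add: a_comm subset_iff)
  then show ?thesis unfolding set_eq_iff line_extension_mem_iff by fastforce
qed

lemma subfield_props:
  assumes "subfield E R"
  shows "E \<subseteq> carrier R" "\<zero> \<in> E" "\<one> \<in> E"
    "\<And>a. a \<in> E \<Longrightarrow> \<ominus> a \<in> E"
    "\<And>a b. a \<in> E \<Longrightarrow> b \<in> E \<Longrightarrow> a \<otimes> b \<in> E"
    "\<And>a b. a \<in> E \<Longrightarrow> b \<in> E \<Longrightarrow> a \<oplus> b \<in> E"
    "\<And>a. a \<in> E \<Longrightarrow> a \<noteq> \<zero> \<Longrightarrow> inv a \<in> E"
proof -
  have "subring E R" using assms by (rule subfieldE(1))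
  then show "E \<subseteq> carrier R" "\<zero> \<in> E" "\<one> \<in> E"
    "\<And>a. a \<in> E \<Longrightarrow> \<ominus> a \<in> E"
    "\<And>a b. a \<in> E \<Longrightarrow> b \<in> E \<Longrightarrow> a \<otimes> b \<in> E"
    "\<And>a b. a \<in> E \<Longrightarrow> b \<in> E \<Longrightarrow> a \<oplus> b \<in> E"
    by (simp_all add: subringE)
  show "\<And>a. a \<in> E \<Longrightarrow> a \<noteq> \<zero> \<Longrightarrow> inv a \<in> E"
    using subfield_m_inv(1)[OF assms] by blast
qed

lemma line_extension_facts:
  assumes "subfield E R" "subfield k R" "k \<subseteq> E" "z \<in> carrier R"
  shows "line_extension k z E \<subseteq> carrier R" "E \<subseteq> line_extension k z E" "z \<in> line_extension k z E"
    "\<And>u v. u \<in> line_extension k z E \<Longrightarrow> v \<in> line_extension k z E \<Longrightarrow> u \<oplus> v \<in> line_extension k z E"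
    "\<And>c v. c \<in> k \<Longrightarrow> v \<in> line_extension k z E \<Longrightarrow> c \<otimes> v \<in> line_extension k z E"
proof -
  note E = subfield_props[OF assms(1)] and k = subfield_props[OF assms(2)]
  note eq = line_extension_eq[OF E(1) k(1) assms(4)]
  show "line_extension k z E \<subseteq> carrier R" using E k assms(4) by (rule_tac line_extension_in_carrier)
  show "E \<subseteq> line_extension k z E"
  proof
    fix e assume "e \<in> E"
    then have "e = e \<oplus> \<zero> \<otimes> z" "e \<in> E" using E(1) assms(4) by auto
    then show "e \<in> line_extension k z E" unfolding eq using k(2) by blast
  qed
  have "z = \<zero> \<oplus> \<one> \<otimes> z" using assms(4) by simp
  then show "z \<in> line_extension k z E" unfolding eq using E(2) k(3) by blast
  have "subgroup E (add_monoid R)" using subring.axioms(1)[OF subfieldE(1)[OF assms(1)]] .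
  then have "subgroup (line_extension k z E) (add_monoid R)"
    using line_extension_is_subgroup[OF assms(2) _ assms(4)] by blast
  then show "u \<oplus> v \<in> line_extension k z E" if "u \<in> line_extension k z E" "v \<in> line_extension k z E" for u v
    using subgroup.m_closed that by fastforce
  show "c \<otimes> v \<in> line_extension k z E" if "c \<in> k" "v \<in> line_extension k z E" for c v
    using line_extension_smult_closed[OF assms(2) _ E(1) assms(4) that] E(5) assms(3) by blast
qed

lemma line_extension_cancel:
  assumes E: "subfield E R" and k: "subfield k R" and sub: "k \<subseteq> E" and z: "z \<in> carrier R"
    and "e \<in> E" "c \<in> k" "c \<noteq> \<zero>" "x \<in> carrier R" "e \<oplus> c \<otimes> x \<in> line_extension k z E"
  shows "x \<in> line_extension k z E"
proof -
  note P = line_extension_facts[OF E k sub z] and Ep = subfield_props[OF E] and kp = subfield_props[OF k]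
  have carr: "e \<in> carrier R" "c \<in> carrier R" using Ep(1) kp(1) assms(5,6) by auto
  have "\<ominus> e \<oplus> (e \<oplus> c \<otimes> x) \<in> line_extension k z E" using P(4)[OF subsetD[OF P(2) Ep(4)]] assms(5,9) by blast
  moreover have "\<ominus> e \<oplus> (e \<oplus> c \<otimes> x) = c \<otimes> x" using carr assms by (simp add: r_neg1)
  ultimately have "inv c \<otimes> (c \<otimes> x) \<in> line_extension k z E" using P(5)[OF kp(7)] assms(6,7,9) by simp
  then show ?thesis using carr assms by (simp add: inv_cancel)
qed

text \<open>
  Put \<open>V = E + k z\<close> and \<open>w = e + c z\<close>. If \<open>c = 0\<close>, then \<open>w\<close> is a unit of \<open>E\<close> and \<open>w E z \<subseteq> V\<close> gives \<open>E z \<subseteq> V\<close>;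
  otherwise \<open>w f = e f + c (f z) \<in> V\<close> gives \<open>f z \<in> V\<close> for \<open>f \<in> E\<close>. So \<open>E z \<subseteq> E + k z\<close> in both cases,
  and \<open>f z = a + b z\<close> with \<open>z \<notin> E\<close> is possible only for \<open>f = b \<in> k\<close>.
\<close>
lemma subfield_eq_of_square_residual:
  assumes E: "subfield E R" and k: "subfield k R" and sub: "k \<subseteq> E"
    and z: "z \<in> carrier R" "z \<notin> E"
    and w: "w \<in> square_residual (line_extension k z E)" "w \<noteq> \<zero>"
  shows "E = k"
proof -
  let ?V = "line_extension k z E"
  note P = line_extension_facts[OF E k sub z(1)] and Ep = subfield_props[OF E] and kp = subfield_props[OF k]
  note eq = line_extension_eq[OF Ep(1) kp(1) z(1)]
  have wc: "w \<in> carrier R" and wV: "\<And>u v. u \<in> ?V \<Longrightarrow> v \<in> ?V \<Longrightarrow> u \<otimes> v \<otimes> w \<in> ?V"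
    using w unfolding square_residual_def by auto
  have one: "\<one> \<in> ?V" using P(2) Ep(3) by blast
  have "w \<in> ?V" using wV[OF one one] wc by simp
  then obtain e c where ec: "e \<in> E" "c \<in> k" "w = e \<oplus> c \<otimes> z" unfolding eq by blast
  have carr: "e \<in> carrier R" "c \<in> carrier R" using ec Ep(1) kp(1) by auto
  have fz: "f \<otimes> z \<in> ?V" if f: "f \<in> E" for f
  proof (cases "c = \<zero>")
    case True
    then have we: "w = e" "e \<noteq> \<zero>" using ec carr z w by auto
    have "inv e \<otimes> f \<in> ?V" using P(2) Ep(5)[OF Ep(7)[OF ec(1) we(2)] f] by blast
    then have "(inv e \<otimes> f) \<otimes> z \<otimes> w \<in> ?V" using wV[OF _ P(3)] by simp
    moreover have "(inv e \<otimes> f) \<otimes> z \<otimes> w = (inv e \<otimes> e) \<otimes> (f \<otimes> z)"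
      using we f Ep(1) carr z(1) by (simp add: m_ac field_inv(1) subset_iff)
    moreover have "\<dots> = f \<otimes> z"
      using we(2) f Ep(1) carr z(1) by (simp add: field_inv subset_iff)
    ultimately show ?thesis by simp
  next
    case False
    have fc: "f \<in> carrier R" using f Ep(1) by blast
    have "\<one> \<otimes> f \<otimes> w \<in> ?V" using wV[OF one subsetD[OF P(2) f]] .
    moreover have "\<one> \<otimes> f \<otimes> w = f \<otimes> e \<oplus> c \<otimes> (f \<otimes> z)"
      using ec fc carr z by (simp add: r_distr m_ac)
    ultimately show ?thesis
      using line_extension_cancel[OF E k sub z(1), of "f \<otimes> e" c "f \<otimes> z"] False f ec(1,2) fc z(1) Ep(5) by simp
  qed
  have "f \<in> k" if f: "f \<in> E" for f
  proof (rule ccontr)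
    assume fk: "f \<notin> k"
    obtain a b where ab: "a \<in> E" "b \<in> k" "f \<otimes> z = a \<oplus> b \<otimes> z"
      using fz[OF f] unfolding eq by blast
    have c: "a \<in> carrier R" "b \<in> carrier R" "f \<in> carrier R" using ab f Ep(1) kp(1) by auto
    have "(f \<ominus> b) \<otimes> z = f \<otimes> z \<ominus> b \<otimes> z" using c z by algebra
    also have "\<dots> = a" unfolding ab(3) using c z by algebra
    finally have 1: "(f \<ominus> b) \<otimes> z = a" .
    have nz: "f \<ominus> b \<noteq> \<zero>" using c fk ab(2) r_right_minus_eq by auto
    have fb: "f \<ominus> b \<in> E"
      unfolding a_minus_def using Ep(6)[OF f Ep(4)[OF subsetD[OF sub ab(2)]]] .
    have "inv (f \<ominus> b) \<otimes> a \<in> E" using Ep(5)[OF Ep(7)[OF fb nz] ab(1)] .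
    moreover have "inv (f \<ominus> b) \<otimes> a = z"
      unfolding 1[symmetric] using c z(1) nz by (simp add: inv_cancel)
    ultimately show False using z(2) by simp
  qed
  then show ?thesis using sub by blast
qed

lemma quadratic_subfield:
  assumes k: "subfield k R" and y: "y \<in> carrier R" "y \<notin> k" and yy: "y \<otimes> y \<in> line_extension k y k"
  shows "subfield (line_extension k y k) R"
proof -
  note P = line_extension_facts[OF k k order_refl y(1)] and kp = subfield_props[OF k]
  note eq = line_extension_eq[OF kp(1) kp(1) y(1)]
  have kc: "a \<in> carrier R" if "a \<in> k" for a using kp(1) that by blast
  obtain p q where pq: "p \<in> k" "q \<in> k" "y \<otimes> y = p \<oplus> q \<otimes> y" using yy unfolding eq by blast
  have mult: "u \<otimes> v \<in> line_extension k y k" if uv: "u \<in> line_extension k y k" "v \<in> line_extension k y k" for u v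
  proof -
    obtain a b c d where ab: "a \<in> k" "b \<in> k" "u = a \<oplus> b \<otimes> y" "c \<in> k" "d \<in> k" "v = c \<oplus> d \<otimes> y"
      using uv unfolding eq by blast
    have "u \<otimes> v = (a \<otimes> c \<oplus> b \<otimes> d \<otimes> p) \<oplus> (a \<otimes> d \<oplus> b \<otimes> c \<oplus> b \<otimes> d \<otimes> q) \<otimes> y"
    proof -
      have "u \<otimes> v = a \<otimes> c \<oplus> (a \<otimes> d \<oplus> b \<otimes> c) \<otimes> y \<oplus> b \<otimes> d \<otimes> (y \<otimes> y)"
        unfolding ab(3,6) using kc[OF ab(1)] kc[OF ab(2)] kc[OF ab(4)] kc[OF ab(5)] y(1) by algebra
      also have "\<dots> = (a \<otimes> c \<oplus> b \<otimes> d \<otimes> p) \<oplus> (a \<otimes> d \<oplus> b \<otimes> c \<oplus> b \<otimes> d \<otimes> q) \<otimes> y"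
        unfolding pq(3)
        using kc[OF ab(1)] kc[OF ab(2)] kc[OF ab(4)] kc[OF ab(5)] kc[OF pq(1)] kc[OF pq(2)] y(1)
        by algebra
      finally show ?thesis .
    qed
    then show ?thesis unfolding eq using ab pq by (blast intro: kp(5,6))
  qed
  have neg: "\<ominus> u \<in> line_extension k y k" if "u \<in> line_extension k y k" for u
    using P(5)[of "\<ominus> \<one>" u] that kp(3,4) P(1) by (auto simp: l_minus subset_iff)
  have "subring (line_extension k y k) R"
    by (rule subringI) (use P kp mult neg in auto)
  moreover have "inv u \<in> line_extension k y k" if u: "u \<in> line_extension k y k - {\<zero>}" for u
  proof -
    obtain a b where ab: "a \<in> k" "b \<in> k" "u = a \<oplus> b \<otimes> y" using u unfolding eq by blast
    have uc: "u \<in> carrier R" "u \<noteq> \<zero>" using u P(1) by auto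
    show ?thesis
    proof (cases "b = \<zero>")
      case True
      then have "u = a" using ab kc y by simp
      then show ?thesis using uc ab kp(7) P(2) by auto
    next
      case False
      \<comment> \<open>With \<open>y\<^sup>2 = p + q y\<close>, the conjugate of \<open>y\<close> is \<open>q - y\<close>; so \<open>v\<close> is the conjugate of \<open>u\<close> and
        \<open>N\<close> is its norm.\<close>
      define v where "v = (a \<oplus> b \<otimes> q) \<oplus> (\<ominus> b) \<otimes> y"
      define N where "N = a \<otimes> a \<oplus> a \<otimes> b \<otimes> q \<ominus> b \<otimes> b \<otimes> p"
      have vP: "v \<in> line_extension k y k" unfolding v_def eq using ab pq by (blast intro: kp(4,5,6))
      have vc: "v \<in> carrier R" using vP P(1) by blast
      have Nk: "N \<in> k" unfolding N_def a_minus_def using ab pq kp by simp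
      have "u \<otimes> v = a \<otimes> a \<oplus> a \<otimes> b \<otimes> q \<oplus> b \<otimes> b \<otimes> q \<otimes> y \<ominus> b \<otimes> b \<otimes> (y \<otimes> y)"
        unfolding ab(3) v_def using kc[OF ab(1)] kc[OF ab(2)] kc[OF pq(2)] y(1) by algebra
      also have "\<dots> = N"
        unfolding N_def pq(3)
        using kc[OF ab(1)] kc[OF ab(2)] kc[OF pq(1)] kc[OF pq(2)] y(1) by algebra
      finally have uv: "u \<otimes> v = N" .
      have "v \<noteq> \<zero>"
      proof
        assume v0: "v = \<zero>"
        have "b \<otimes> y = (a \<oplus> b \<otimes> q) \<ominus> v"
          unfolding v_def using kc[OF ab(1)] kc[OF ab(2)] kc[OF pq(2)] y(1) by algebra
        then have "b \<otimes> y = a \<oplus> b \<otimes> q"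
          using v0 kc[OF ab(1)] kc[OF ab(2)] kc[OF pq(2)] by (simp add: a_minus_def)
        then have "b \<otimes> y \<in> k" using ab pq kp by simp
        then have "inv b \<otimes> (b \<otimes> y) \<in> k" using kp(5,7) ab False by blast
        then show False using y kc[OF ab(2)] False by (simp add: inv_cancel)
      qed
      then have N0: "N \<noteq> \<zero>" using uv uc vc integral_iff by auto
      then have Ni: "inv N \<in> k" "inv N \<in> carrier R" using kp(7) Nk kc by auto
      have "u \<otimes> (inv N \<otimes> v) = inv N \<otimes> (u \<otimes> v)" using uc vc Ni by (simp add: m_ac)
      also have "\<dots> = \<one>" using uv field_inv(3)[OF kc[OF Nk] N0] by simp
      finally have "inv u = inv N \<otimes> v"
        using comm_inv_char[OF uc(1)] vc Ni by simp
      then show ?thesis using P(5) Ni vP by simp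
    qed
  qed
  ultimately show ?thesis by (rule subfieldI')
qed

text \<open>
  For \<open>y \<notin> k\<close> and \<open>V = k + k y\<close>, an element \<open>w = a + b y\<close> with \<open>w V\<^sup>2 \<subseteq> V\<close> yields \<open>y\<^sup>2 \<in> V\<close>, from
  \<open>w y\<^sup>2\<close> if \<open>b = 0\<close> and from \<open>w y\<close> otherwise. So \<open>V\<close> is a field \<open>E\<close> of degree two, and an element
  \<open>z \<notin> E\<close> would force \<open>E = k\<close> by the preceding comparison of \<open>E\<close> and \<open>k\<close> in \<open>E + k z\<close>.
\<close>
lemma dimension_2_of_square_residuals:
  assumes k: "subfield k R" and ne: "k \<noteq> carrier R"
    and res: "\<And>V. V \<subseteq> carrier R \<Longrightarrow> (\<And>u v. u \<in> V \<Longrightarrow> v \<in> V \<Longrightarrow> u \<oplus> v \<in> V) \<Longrightarrow>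
        (\<And>c v. c \<in> k \<Longrightarrow> v \<in> V \<Longrightarrow> c \<otimes> v \<in> V) \<Longrightarrow> \<one> \<in> V \<Longrightarrow>
        \<exists>w\<in>square_residual V. w \<noteq> \<zero>"
  shows "dimension 2 k (carrier R)"
proof -
  note kp = subfield_props[OF k]
  have kc: "a \<in> carrier R" if "a \<in> k" for a using kp(1) that by blast
  obtain y where y: "y \<in> carrier R" "y \<notin> k" using ne kp(1) by blast
  let ?E = "line_extension k y k"
  note P = line_extension_facts[OF k k order_refl y(1)] and eq = line_extension_eq[OF kp(1) kp(1) y(1)]
  have "y \<otimes> y \<in> ?E"
  proof -
    have one: "\<one> \<in> ?E" using P(2) kp(3) by blast
    obtain w where w: "w \<in> square_residual ?E" "w \<noteq> \<zero>"
      using res[OF P(1) P(4) P(5) one] by blast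
    have wc: "w \<in> carrier R" and wV: "\<And>u v. u \<in> ?E \<Longrightarrow> v \<in> ?E \<Longrightarrow> u \<otimes> v \<otimes> w \<in> ?E"
      using w unfolding square_residual_def by auto
    have "w \<in> ?E" using wV[OF one one] wc by simp
    then obtain a b where ab: "a \<in> k" "b \<in> k" "w = a \<oplus> b \<otimes> y" unfolding eq by blast
    note c = kc[OF ab(1)] kc[OF ab(2)]
    show ?thesis
    proof (cases "b = \<zero>")
      case True
      then have "w = a" using ab c y by simp
      then have "\<zero> \<oplus> a \<otimes> (y \<otimes> y) \<in> ?E" "a \<noteq> \<zero>"
        using wV[OF P(3) P(3)] w(2) c y m_comm[of a "y \<otimes> y"] by auto
      then show ?thesis using line_extension_cancel[OF k k order_refl y(1)] kp(2) ab(1) y(1) by blast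
    next
      case False
      have "\<one> \<otimes> y \<otimes> w \<in> ?E" using wV[OF one P(3)] .
      moreover have "\<one> \<otimes> y \<otimes> w = a \<otimes> y \<oplus> b \<otimes> (y \<otimes> y)"
        using c y unfolding ab(3) by (simp add: r_distr m_ac)
      ultimately have "(\<ominus> a) \<otimes> y \<oplus> (a \<otimes> y \<oplus> b \<otimes> (y \<otimes> y)) \<in> ?E"
        using P(3,4,5) kp(4) ab(1) by simp
      moreover have "(\<ominus> a) \<otimes> y \<oplus> (a \<otimes> y \<oplus> b \<otimes> (y \<otimes> y)) = \<zero> \<oplus> b \<otimes> (y \<otimes> y)"
        using c y(1) by algebra
      ultimately show ?thesis
        using line_extension_cancel[OF k k order_refl y(1) kp(2) ab(2) False, of "y \<otimes> y"] y(1) by simp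
    qed
  qed
  then have E: "subfield ?E R" by (rule quadratic_subfield[OF k y])
  have "?E = carrier R"
  proof (rule ccontr)
    assume "?E \<noteq> carrier R"
    then obtain z where z: "z \<in> carrier R" "z \<notin> ?E" using P(1) by blast
    note P' = line_extension_facts[OF E k P(2) z(1)]
    have "\<one> \<in> line_extension k z ?E" using P'(2) P(2) kp(3) by blast
    then obtain w where w: "w \<in> square_residual (line_extension k z ?E)" "w \<noteq> \<zero>"
      using res[OF P'(1) P'(4) P'(5)] by blast
    have "?E = k" using subfield_eq_of_square_residual[OF E k P(2) z w] .
    then show False using P(3) y by simp
  qed
  moreover have "dimension 2 k (line_extension k y k)"
    using Suc_dim[OF y dimension_one[OF k]] by (simp add: numeral_2_eq_2)
  ultimately show ?thesis by simp
qed

text \<open>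
  An element of \<open>V\<close> outside \<open>k\<close> is independent of \<open>1\<close>, and the two would span the whole field.
\<close>
lemma proper_subspace_of_dimension_2:
  assumes k: "subfield k R" and dim: "dimension 2 k (carrier R)"
    and V: "V \<subseteq> carrier R" "\<And>u v. u \<in> V \<Longrightarrow> v \<in> V \<Longrightarrow> u \<oplus> v \<in> V"
      "\<And>c v. c \<in> k \<Longrightarrow> v \<in> V \<Longrightarrow> c \<otimes> v \<in> V" "\<one> \<in> V" "V \<noteq> carrier R"
  shows "V = k"
proof
  note kp = subfield_props[OF k]
  show kV: "k \<subseteq> V" using V(3)[OF _ V(4)] kp(1) by force
  show "V \<subseteq> k"
  proof
    fix v assume v: "v \<in> V"
    show "v \<in> k"
    proof (rule ccontr)
      assume vk: "v \<notin> k"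
      have Sp1: "Span k [\<one>] = k"
      proof -
        have "line_extension k \<one> {\<zero>} = k"
          using kp(1) by (auto simp: line_extension_mem_iff subset_iff)
        then show ?thesis by simp
      qed
      have "independent k [\<one>]"
        using li_Cons[of \<one> k "[]"] by simp
      then have "independent k [v, \<one>]"
        using li_Cons[of v k "[\<one>]"] v V(1) vk unfolding Sp1 by blast
      then have "Span k [v, \<one>] = carrier R"
        using independent_length_eq_dimension[OF k dim, of "[v, \<one>]"] v V(1) by auto
      then have "line_extension k v k = carrier R" using Sp1 by simp
      moreover have "line_extension k v k \<subseteq> V"
        using V(2,3) v subsetD[OF kV] by (auto simp: line_extension_mem_iff)
      ultimately show False using V(1,5) by blast
    qed
  qed
qed

end

section \<open>Pullbacks along a map onto a field\<close>

text \<open>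
  The residue field enters only through a surjective ring homomorphism \<open>\<phi>\<close> from \<open>T\<close> onto a field \<open>K\<close>; its
  kernel is the maximal ideal, and \<open>R\<close> is the preimage of \<open>D\<close>. This keeps cosets out of the
  arguments.
\<close>
locale residue_pullback = domain_in_field L T + K: field K
  for L :: "('a, 'b) ring_scheme" (structure) and T and K :: "('c, 'd) ring_scheme" +
  fixes \<phi> :: "'a \<Rightarrow> 'c" and D :: "'c set"
  assumes hom: "\<phi> \<in> ring_hom (L\<lparr>carrier := T\<rparr>) K"
    and surj: "\<phi> ` T = carrier K"
    and subring_D: "subring D K"
begin

sublocale D: domain_in_field K D
  by (rule domain_in_field.intro[OF K.field_axioms domain_in_field_axioms.intro[OF subring_D]])

lemma phi_carrier: "x \<in> T \<Longrightarrow> \<phi> x \<in> carrier K"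
  and phi_mult: "x \<in> T \<Longrightarrow> y \<in> T \<Longrightarrow> \<phi> (x \<otimes> y) = \<phi> x \<otimes>\<^bsub>K\<^esub> \<phi> y"
  and phi_add: "x \<in> T \<Longrightarrow> y \<in> T \<Longrightarrow> \<phi> (x \<oplus> y) = \<phi> x \<oplus>\<^bsub>K\<^esub> \<phi> y"
  and phi_one: "\<phi> \<one> = \<one>\<^bsub>K\<^esub>"
  using ring_hom_memE[OF hom] by simp_all

lemma phi_zero: "\<phi> \<zero> = \<zero>\<^bsub>K\<^esub>"
proof -
  have "\<phi> \<zero> \<oplus>\<^bsub>K\<^esub> \<phi> \<zero> = \<phi> \<zero>" using phi_add[of \<zero> \<zero>] A_props(2) by simp
  then show ?thesis using K.add.l_cancel_one phi_carrier[OF A_props(2)] by simp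
qed

lemma phi_minus:
  assumes "x \<in> T" "y \<in> T"
  shows "x \<ominus> y \<in> T" "\<phi> (x \<ominus> y) = \<phi> x \<ominus>\<^bsub>K\<^esub> \<phi> y"
proof -
  show xy: "x \<ominus> y \<in> T" unfolding a_minus_def using assms A_props(5,7) by blast
  have c: "x \<in> carrier L" "y \<in> carrier L" using assms A_carrier by auto
  have "x \<ominus> y \<oplus> y = x" using c by algebra
  then have "\<phi> (x \<ominus> y) \<oplus>\<^bsub>K\<^esub> \<phi> y = \<phi> x" using phi_add[OF xy assms(2)] by simp
  then show "\<phi> (x \<ominus> y) = \<phi> x \<ominus>\<^bsub>K\<^esub> \<phi> y"
    using phi_carrier[OF xy] phi_carrier assms K.add.inv_solve_right by (simp add: K.minus_eq)
qed

lemma phi_surj: "v \<in> carrier K \<Longrightarrow> \<exists>x\<in>T. \<phi> x = v"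
  unfolding surj[symmetric] by auto

definition preimage :: "'c set \<Rightarrow> 'a set" where
  "preimage V = {x \<in> T. \<phi> x \<in> V}"

lemma preimage_T: "x \<in> preimage V \<Longrightarrow> x \<in> T"
  unfolding preimage_def by blast

lemma phi_preimage: "x \<in> preimage V \<Longrightarrow> \<phi> x \<in> V"
  unfolding preimage_def by blast

lemma image_preimage: "V \<subseteq> carrier K \<Longrightarrow> \<phi> ` preimage V = V"
  unfolding preimage_def surj[symmetric] by auto

lemma preimage_subring: "subring (preimage D) L"
proof (rule subringI)
  show "preimage D \<subseteq> carrier L" using preimage_T A_carrier by blast
  show "\<ominus> x \<in> preimage D" if x: "x \<in> preimage D" for x
  proof -
    have "\<zero> \<ominus> x = \<ominus> x" using A_carrier[OF preimage_T[OF x]] by (simp add: a_minus_def)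
    moreover have "\<phi> (\<zero> \<ominus> x) = \<ominus>\<^bsub>K\<^esub> \<phi> x"
      using phi_minus(2)[OF A_props(2) preimage_T[OF x]] phi_zero
        phi_carrier[OF preimage_T[OF x]] by (simp add: K.minus_eq)
    ultimately show ?thesis
      using phi_minus(1)[OF A_props(2) preimage_T[OF x]] phi_preimage[OF x] D.A_props(5)
      unfolding preimage_def by simp
  qed
qed (auto simp: preimage_def A_props D.A_props phi_one phi_mult phi_add)

sublocale R: domain_in_field L "preimage D"
  by (rule domain_in_field.intro[OF field_axioms domain_in_field_axioms.intro[OF preimage_subring]])

lemma exists_inverse_mod_kernel:
  assumes j: "j \<in> T" "\<phi> j \<noteq> \<zero>\<^bsub>K\<^esub>"
  obtains s m where "s \<in> T" "m \<in> T" "\<phi> m = \<zero>\<^bsub>K\<^esub>" "j \<otimes> s \<oplus> m = \<one>"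
proof -
  note i = K.field_inv[OF phi_carrier[OF j(1)] j(2)]
  obtain s where s: "s \<in> T" "\<phi> s = inv\<^bsub>K\<^esub> \<phi> j" using phi_surj[OF i(1)] by blast
  have js: "j \<otimes> s \<in> T" "j \<otimes> s \<in> carrier L" using A_props(6)[OF j(1) s(1)] A_carrier by auto
  let ?m = "\<one> \<ominus> j \<otimes> s"
  have "\<phi> (j \<otimes> s) = \<one>\<^bsub>K\<^esub>" using phi_mult[OF j(1) s(1)] s(2) i(2) by simp
  then have "\<phi> ?m = \<zero>\<^bsub>K\<^esub>"
    using phi_minus(2)[OF A_props(3) js(1)] phi_one by (simp add: K.minus_eq K.r_neg)
  moreover have "?m \<in> T" using phi_minus(1)[OF A_props(3) js(1)] .
  moreover have "j \<otimes> s \<oplus> ?m = \<one>" using js(2) by algebra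
  ultimately show ?thesis using that s(1) by blast
qed

definition D_submodule :: "'c set \<Rightarrow> bool" where
  "D_submodule V \<longleftrightarrow> V \<subseteq> carrier K \<and> (\<forall>u\<in>V. \<forall>v\<in>V. u \<oplus>\<^bsub>K\<^esub> v \<in> V) \<and>
     (\<forall>d\<in>D. \<forall>v\<in>V. d \<otimes>\<^bsub>K\<^esub> v \<in> V) \<and> (\<exists>v\<in>V. v \<noteq> \<zero>\<^bsub>K\<^esub>)"

lemma D_submodule_props:
  assumes "D_submodule V"
  shows "V \<subseteq> carrier K" "\<And>u v. u \<in> V \<Longrightarrow> v \<in> V \<Longrightarrow> u \<oplus>\<^bsub>K\<^esub> v \<in> V"
    "\<And>d v. d \<in> D \<Longrightarrow> v \<in> V \<Longrightarrow> d \<otimes>\<^bsub>K\<^esub> v \<in> V" "\<zero>\<^bsub>K\<^esub> \<in> V"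
    "\<exists>j\<in>preimage V. \<phi> j \<noteq> \<zero>\<^bsub>K\<^esub>"
proof -
  show V: "V \<subseteq> carrier K" "\<And>u v. u \<in> V \<Longrightarrow> v \<in> V \<Longrightarrow> u \<oplus>\<^bsub>K\<^esub> v \<in> V"
    "\<And>d v. d \<in> D \<Longrightarrow> v \<in> V \<Longrightarrow> d \<otimes>\<^bsub>K\<^esub> v \<in> V"
    using assms unfolding D_submodule_def by blast+
  obtain v where v: "v \<in> V" "v \<noteq> \<zero>\<^bsub>K\<^esub>" using assms unfolding D_submodule_def by blast
  have vc: "v \<in> carrier K" using v V(1) by blast
  show "\<zero>\<^bsub>K\<^esub> \<in> V" using V(3)[OF D.A_props(2) v(1)] vc by simp
  show "\<exists>j\<in>preimage V. \<phi> j \<noteq> \<zero>\<^bsub>K\<^esub>"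
    using phi_surj[OF vc] v unfolding preimage_def by auto
qed

lemma preimage_fractional_ideal:
  assumes V: "D_submodule V"
    and d: "d \<in> preimage D" "d \<noteq> \<zero>" "\<And>x. x \<in> preimage V \<Longrightarrow> d \<otimes> x \<in> preimage D"
  shows "preimage V \<in> R.FI"
proof -
  note VD = D_submodule_props[OF V]
  obtain j where j: "j \<in> preimage V" "\<phi> j \<noteq> \<zero>\<^bsub>K\<^esub>" using VD(5) by blast
  show ?thesis
  proof (rule R.FI_I[where d = d and x = j])
    show "preimage V \<subseteq> R.Q" using d preimage_T A_carrier R.quot_field_iff by blast
    show "j \<noteq> \<zero>" using j(2) phi_zero by auto
    show "x \<oplus> y \<in> preimage V" if "x \<in> preimage V" "y \<in> preimage V" for x y
      using that VD(2) A_props(7) by (simp add: preimage_def phi_add)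
    show "a \<otimes> x \<in> preimage V" if "a \<in> preimage D" "x \<in> preimage V" for a x
      using that VD(3) A_props(6) by (simp add: preimage_def phi_mult)
  qed (use d j in auto)
qed

text \<open>
  The preimage \<open>J\<close> of \<open>V\<close> contains the kernel and an element outside of it, so \<open>J T = T\<close>: there is a
  relation \<open>j s + m = 1\<close> with \<open>j, m \<in> J\<close>. Multiplying \<open>h\<close> by the square of this relation writes \<open>h\<close> in terms
  of \<open>j\<^sup>2 h, j m h, m\<^sup>2 h \<in> J \<subseteq> T\<close>. Hence the residual of \<open>J\<close> lies in \<open>T\<close>, where \<open>\<phi>\<close> can be applied.
\<close>
lemma square_residual_preimage:
  assumes V: "D_submodule V" and h: "h \<in> square_residual (preimage V)"
  shows "h \<in> T" "\<phi> h \<in> K.square_residual V"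
proof -
  note VD = D_submodule_props[OF V]
  have hc: "h \<in> carrier L" and hJ: "\<And>i j. i \<in> preimage V \<Longrightarrow> j \<in> preimage V \<Longrightarrow> i \<otimes> j \<otimes> h \<in> T"
    "\<And>i j. i \<in> preimage V \<Longrightarrow> j \<in> preimage V \<Longrightarrow> \<phi> (i \<otimes> j \<otimes> h) \<in> V"
    using h unfolding square_residual_def preimage_def by auto
  obtain j where j: "j \<in> preimage V" "\<phi> j \<noteq> \<zero>\<^bsub>K\<^esub>" using VD(5) by blast
  obtain s m where sm: "s \<in> T" "m \<in> T" "\<phi> m = \<zero>\<^bsub>K\<^esub>" "j \<otimes> s \<oplus> m = \<one>"
    using exists_inverse_mod_kernel preimage_T j by blast
  have m: "m \<in> preimage V" using sm VD(4) unfolding preimage_def by simp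
  have c: "j \<in> carrier L" "s \<in> carrier L" "m \<in> carrier L" using j sm preimage_T A_carrier by auto
  have "(j \<otimes> s \<oplus> m) \<otimes> (j \<otimes> s \<oplus> m) \<otimes> h =
      s \<otimes> s \<otimes> (j \<otimes> j \<otimes> h) \<oplus> (s \<otimes> (j \<otimes> m \<otimes> h) \<oplus> s \<otimes> (j \<otimes> m \<otimes> h)) \<oplus> m \<otimes> m \<otimes> h"
    using c hc by algebra
  then have "h = s \<otimes> s \<otimes> (j \<otimes> j \<otimes> h) \<oplus> (s \<otimes> (j \<otimes> m \<otimes> h) \<oplus> s \<otimes> (j \<otimes> m \<otimes> h)) \<oplus> m \<otimes> m \<otimes> h"
    unfolding sm(4) using hc by simp
  moreover have "\<dots> \<in> T" using hJ(1) j(1) m sm(1) A_props(6,7) by simp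
  ultimately show hT: "h \<in> T" by simp
  have "u \<otimes>\<^bsub>K\<^esub> v \<otimes>\<^bsub>K\<^esub> \<phi> h \<in> V" if uv: "u \<in> V" "v \<in> V" for u v
  proof -
    obtain x y where xy: "x \<in> preimage V" "y \<in> preimage V" "\<phi> x = u" "\<phi> y = v"
      using uv image_preimage[OF VD(1)] by (metis imageE)
    have "\<phi> (x \<otimes> y \<otimes> h) = u \<otimes>\<^bsub>K\<^esub> v \<otimes>\<^bsub>K\<^esub> \<phi> h"
      using xy hT preimage_T A_props(6) by (simp add: phi_mult)
    then show ?thesis using hJ(2)[OF xy(1,2)] by simp
  qed
  then show "\<phi> h \<in> K.square_residual V"
    unfolding K.square_residual_def using phi_carrier[OF hT] by blast
qed

lemma phi_ideal_prod:
  assumes "S \<subseteq> T" "S' \<subseteq> T"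
  shows "S \<cdot> S' \<subseteq> T" "\<phi> ` (S \<cdot> S') \<subseteq> \<phi> ` S \<cdot>\<^bsub>K\<^esub> \<phi> ` S'"
proof -
  have "S \<cdot> S' \<subseteq> {x \<in> T. \<phi> x \<in> \<phi> ` S \<cdot>\<^bsub>K\<^esub> \<phi> ` S'}"
  proof (rule ideal_prod_subsetI)
    fix i j assume ij: "i \<in> S" "j \<in> S'"
    then have "i \<in> T" "j \<in> T" using assms by auto
    then show "i \<otimes> j \<in> {x \<in> T. \<phi> x \<in> \<phi> ` S \<cdot>\<^bsub>K\<^esub> \<phi> ` S'}"
      using ij by (auto simp: phi_mult A_props(6) intro: ideal_prod.prod)
  qed (auto simp: phi_add A_props(7) intro: ideal_prod.sum)
  then show "S \<cdot> S' \<subseteq> T" "\<phi> ` (S \<cdot> S') \<subseteq> \<phi> ` S \<cdot>\<^bsub>K\<^esub> \<phi> ` S'" by auto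
qed

lemma clifford_ideal_of_preimage:
  assumes V: "D_submodule V" and cl: "clifford_ideal (preimage V)"
  shows "K.clifford_ideal V"
proof -
  note VD = D_submodule_props[OF V]
  let ?J = "preimage V" and ?H = "square_residual (preimage V)"
  have JT: "?J \<subseteq> T" using preimage_T by blast
  have HT: "?H \<subseteq> T" "\<phi> ` ?H \<subseteq> K.square_residual V" using square_residual_preimage[OF V] by auto
  have "V = \<phi> ` ?J" using image_preimage[OF VD(1)] by simp
  also have "\<dots> \<subseteq> \<phi> ` (?J \<cdot> ?J \<cdot> ?H)" using cl unfolding clifford_ideal_def by blast
  also have "\<dots> \<subseteq> \<phi> ` (?J \<cdot> ?J) \<cdot>\<^bsub>K\<^esub> \<phi> ` ?H"
    by (rule phi_ideal_prod(2)[OF phi_ideal_prod(1)[OF JT JT] HT(1)])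
  also have "\<dots> \<subseteq> (\<phi> ` ?J \<cdot>\<^bsub>K\<^esub> \<phi> ` ?J) \<cdot>\<^bsub>K\<^esub> K.square_residual V"
    by (rule K.ideal_prod_mono[OF phi_ideal_prod(2)[OF JT JT] HT(2)])
  also have "\<dots> = V \<cdot>\<^bsub>K\<^esub> V \<cdot>\<^bsub>K\<^esub> K.square_residual V" using image_preimage[OF VD(1)] by simp
  finally show ?thesis unfolding K.clifford_ideal_def .
qed

text \<open>
  As \<open>J T = T\<close>, the relation \<open>J\<^sup>2 = c J\<close> gives \<open>c \<in> c J T \<subseteq> T\<close>, and it can be pushed forward along \<open>\<phi>\<close>.
\<close>
lemma square_similar_of_preimage:
  assumes V: "D_submodule V" and c: "c \<in> carrier L" and eq: "preimage V \<cdot> preimage V = c <# preimage V"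
  shows "\<exists>e\<in>carrier K. e \<noteq> \<zero>\<^bsub>K\<^esub> \<and> V \<cdot>\<^bsub>K\<^esub> V = e <#\<^bsub>K\<^esub> V"
proof -
  note VD = D_submodule_props[OF V]
  let ?J = "preimage V"
  have JT: "?J \<subseteq> T" using preimage_T by blast
  obtain j where j: "j \<in> ?J" "\<phi> j \<noteq> \<zero>\<^bsub>K\<^esub>" using VD(5) by blast
  obtain s m where sm: "s \<in> T" "m \<in> T" "\<phi> m = \<zero>\<^bsub>K\<^esub>" "j \<otimes> s \<oplus> m = \<one>"
    using exists_inverse_mod_kernel preimage_T j by blast
  have m: "m \<in> ?J" using sm VD(4) unfolding preimage_def by simp
  have JJ: "?J \<cdot> ?J \<subseteq> T" by (rule phi_ideal_prod(1)[OF JT JT])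
  have cJ: "c \<otimes> x \<in> T" if "x \<in> ?J" for x using JJ eq l_coset_memI[OF that] by auto
  have carr: "j \<in> carrier L" "s \<in> carrier L" "m \<in> carrier L" using j sm preimage_T A_carrier by auto
  have "c \<otimes> (j \<otimes> s \<oplus> m) = (c \<otimes> j) \<otimes> s \<oplus> c \<otimes> m" using carr c by (simp add: r_distr m_assoc)
  then have "c = (c \<otimes> j) \<otimes> s \<oplus> c \<otimes> m" unfolding sm(4) using c by simp
  moreover have "\<dots> \<in> T" using cJ j m sm A_props(6,7) by simp
  ultimately have cT: "c \<in> T" by simp
  have ec: "\<phi> c \<in> carrier K" using phi_carrier[OF cT] .
  have VV: "V \<cdot>\<^bsub>K\<^esub> V = \<phi> c <#\<^bsub>K\<^esub> V"
  proof
    show "V \<cdot>\<^bsub>K\<^esub> V \<subseteq> \<phi> c <#\<^bsub>K\<^esub> V"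
    proof (rule K.ideal_prod_subsetI)
      fix u v assume uv: "u \<in> V" "v \<in> V"
      obtain x y where xy: "x \<in> ?J" "y \<in> ?J" "\<phi> x = u" "\<phi> y = v"
        using uv image_preimage[OF VD(1)] by (metis imageE)
      have "x \<otimes> y \<in> c <# ?J" using ideal_prod.prod[OF xy(1,2), of L] eq by simp
      then obtain z where z: "z \<in> ?J" "x \<otimes> y = c \<otimes> z" unfolding l_coset_def by blast
      have "u \<otimes>\<^bsub>K\<^esub> v = \<phi> c \<otimes>\<^bsub>K\<^esub> \<phi> z"
        using phi_mult[of x y] phi_mult[of c z] xy z cT preimage_T by metis
      then show "u \<otimes>\<^bsub>K\<^esub> v \<in> \<phi> c <#\<^bsub>K\<^esub> V" using K.l_coset_memI[OF phi_preimage[OF z(1)]] by simp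
    next
      fix u v assume "u \<in> \<phi> c <#\<^bsub>K\<^esub> V" "v \<in> \<phi> c <#\<^bsub>K\<^esub> V"
      then obtain i j where ij: "i \<in> V" "j \<in> V" "u = \<phi> c \<otimes>\<^bsub>K\<^esub> i" "v = \<phi> c \<otimes>\<^bsub>K\<^esub> j"
        unfolding l_coset_def by blast
      then have "u \<oplus>\<^bsub>K\<^esub> v = \<phi> c \<otimes>\<^bsub>K\<^esub> (i \<oplus>\<^bsub>K\<^esub> j)" using ec VD(1) by (simp add: K.r_distr subset_iff)
      then show "u \<oplus>\<^bsub>K\<^esub> v \<in> \<phi> c <#\<^bsub>K\<^esub> V" using K.l_coset_memI[OF VD(2)[OF ij(1,2)]] by simp
    qed
    show "\<phi> c <#\<^bsub>K\<^esub> V \<subseteq> V \<cdot>\<^bsub>K\<^esub> V"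
    proof
      fix u assume "u \<in> \<phi> c <#\<^bsub>K\<^esub> V"
      then obtain i where i: "i \<in> V" "u = \<phi> c \<otimes>\<^bsub>K\<^esub> i" unfolding l_coset_def by blast
      obtain x where x: "x \<in> ?J" "\<phi> x = i" using i(1) image_preimage[OF VD(1)] by (metis imageE)
      have "u = \<phi> (c \<otimes> x)" using phi_mult[OF cT preimage_T[OF x(1)]] x i by simp
      also have "\<dots> \<in> \<phi> ` (?J \<cdot> ?J)" unfolding eq using l_coset_memI[OF x(1)] by blast
      finally show "u \<in> V \<cdot>\<^bsub>K\<^esub> V"
        using phi_ideal_prod(2)[OF JT JT] image_preimage[OF VD(1)] by auto
    qed
  qed
  have "\<phi> c \<noteq> \<zero>\<^bsub>K\<^esub>"
  proof
    assume "\<phi> c = \<zero>\<^bsub>K\<^esub>"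
    then have "V \<cdot>\<^bsub>K\<^esub> V \<subseteq> {\<zero>\<^bsub>K\<^esub>}" unfolding VV l_coset_def using VD(1) by auto
    moreover have "\<phi> j \<otimes>\<^bsub>K\<^esub> \<phi> j \<in> V \<cdot>\<^bsub>K\<^esub> V"
      using phi_preimage[OF j(1)] by (rule ideal_prod.prod[rotated])(rule phi_preimage[OF j(1)])
    ultimately show False
      using j(2) phi_carrier[OF preimage_T[OF j(1)]] K.integral_iff by blast
  qed
  then show ?thesis using ec VV by blast
qed

lemma D_fractional_ideal_lift:
  assumes V: "V \<in> D.FI"
  shows "D_submodule V" "preimage V \<in> R.FI"
proof -
  note VD = D.FI_D[OF V]
  show sub: "D_submodule V" unfolding D_submodule_def using VD by blast
  obtain d' where d': "d' \<in> D" "d' \<noteq> \<zero>\<^bsub>K\<^esub>" "\<forall>x\<in>V. d' \<otimes>\<^bsub>K\<^esub> x \<in> D" using VD(6) by blast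
  obtain d where d: "d \<in> T" "\<phi> d = d'" using phi_surj D.A_carrier[OF d'(1)] by blast
  show "preimage V \<in> R.FI"
  proof (rule preimage_fractional_ideal[OF sub])
    show "d \<in> preimage D" using d d' unfolding preimage_def by simp
    show "d \<noteq> \<zero>" using d d' phi_zero by auto
    show "d \<otimes> x \<in> preimage D" if "x \<in> preimage V" for x
      using that d d' A_props(6) by (simp add: preimage_def phi_mult)
  qed
qed

lemma clifford_regular_D:
  assumes "clifford_regular L (preimage D)"
  shows "clifford_regular K D"
  unfolding D.clifford_regular_iff
proof
  fix V assume V: "V \<in> D.FI"
  note lift = D_fractional_ideal_lift[OF V]
  show "K.clifford_ideal V"
    using clifford_ideal_of_preimage[OF lift(1)] lift(2) assms R.clifford_regular_iff by blast
qed

lemma boole_regular_D: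
  assumes "boole_regular L (preimage D)"
  shows "boole_regular K D"
  unfolding D.boole_regular_iff
proof
  fix V assume V: "V \<in> D.FI"
  note VD = D.FI_D[OF V] and lift = D_fractional_ideal_lift[OF V]
  obtain c where c: "c \<in> R.Q" "preimage V \<cdot> preimage V = c <# preimage V"
    using assms lift(2) R.boole_regular_iff by blast
  obtain e where e: "e \<in> carrier K" "e \<noteq> \<zero>\<^bsub>K\<^esub>" "V \<cdot>\<^bsub>K\<^esub> V = e <#\<^bsub>K\<^esub> V"
    using square_similar_of_preimage[OF lift(1) R.Q_carrier[OF c(1)] c(2)] by blast
  obtain v where v: "v \<in> V" "v \<noteq> \<zero>\<^bsub>K\<^esub>" using VD(7) by blast
  have vc: "v \<in> carrier K" using v VD(2) by blast
  \<comment> \<open>So far \<open>e\<close> is only known to lie in \<open>K\<close>; it is a quotient of elements of \<open>V\<^sup>2\<close> and \<open>V\<close>.\<close>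
  have "e \<otimes>\<^bsub>K\<^esub> v \<in> V \<cdot>\<^bsub>K\<^esub> V" unfolding e(3) using K.l_coset_memI[OF v(1)] .
  then have "e \<otimes>\<^bsub>K\<^esub> v \<in> D.Q" using D.FI_D(1)[OF D.FI_ideal_prod[OF V V]] by blast
  then have "(e \<otimes>\<^bsub>K\<^esub> v) \<otimes>\<^bsub>K\<^esub> inv\<^bsub>K\<^esub> v \<in> D.Q"
    using D.Q_mult D.Q_inv[OF subsetD[OF VD(1) v(1)] v(2)] by blast
  then have "e \<in> D.Q" using e(1) vc v(2) by (simp add: K.m_assoc K.field_inv)
  then show "\<exists>c\<in>D.Q. c \<noteq> \<zero>\<^bsub>K\<^esub> \<and> V \<cdot>\<^bsub>K\<^esub> V = c <#\<^bsub>K\<^esub> V" using e by blast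
qed

text \<open>
  With trivial kernel, \<open>T\<close> is isomorphic to \<open>K\<close>, hence a field, and its class semigroup is trivial.
\<close>
lemma boole_regular_T_of_trivial_kernel:
  assumes "\<And>m. m \<in> T \<Longrightarrow> \<phi> m = \<zero>\<^bsub>K\<^esub> \<Longrightarrow> m = \<zero>"
  shows "boole_regular L T"
proof (rule boole_regular_field)
  fix a assume a: "a \<in> T" "a \<noteq> \<zero>"
  then have "\<phi> a \<noteq> \<zero>\<^bsub>K\<^esub>" using assms by blast
  then obtain s m where s: "s \<in> T" "m \<in> T" "\<phi> m = \<zero>\<^bsub>K\<^esub>" "a \<otimes> s \<oplus> m = \<one>"
    using exists_inverse_mod_kernel a by blast
  then have "a \<otimes> s = \<one>" using assms[of m] a A_carrier by simp
  then have "inv a = s" using comm_inv_char a s A_carrier by simp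
  then show "inv a \<in> T" using s by simp
qed

end

text \<open>
  A nonzero kernel element \<open>m\<close> satisfies \<open>m T \<subseteq> R\<close>, so \<open>T\<close> and \<open>R\<close> have the same quotient field, and the
  preimage of every \<open>D\<close>-submodule of \<open>K\<close> has the denominator \<open>m\<close>.
\<close>
locale nontrivial_residue_pullback = residue_pullback +
  fixes m
  assumes m: "m \<in> T" "\<phi> m = \<zero>\<^bsub>K\<^esub>" "m \<noteq> \<zero>"
begin

lemma kernel_mult:
  assumes "x \<in> T" "\<phi> x = \<zero>\<^bsub>K\<^esub>" "t \<in> T"
  shows "x \<otimes> t \<in> preimage D" "t \<otimes> x \<in> preimage D"
  using assms A_props(6) phi_carrier[OF assms(3)] D.A_props(2)
  by (simp_all add: preimage_def phi_mult)

lemma m_conductor: "m \<in> preimage D" "\<forall>t\<in>T. m \<otimes> t \<in> preimage D"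
  using m D.A_props(2) kernel_mult(1) by (simp_all add: preimage_def)

lemma preimage_D_T: "preimage D \<subseteq> T"
  using preimage_T by blast

lemmas T_over_R = R.overring_with_conductor[OF subring_A preimage_D_T m_conductor(1) m(3) m_conductor(2)]

lemma clifford_regular_T: "clifford_regular L (preimage D) \<Longrightarrow> clifford_regular L T"
  unfolding R.clifford_regular_iff clifford_regular_iff using T_over_R(2) by blast

lemma boole_regular_T: "boole_regular L (preimage D) \<Longrightarrow> boole_regular L T"
  unfolding R.boole_regular_iff boole_regular_iff T_over_R(1)
  by (intro ballI, erule bspec) (rule subsetD[OF T_over_R(2)])

text \<open>
  The preimage of any \<open>k\<close>-subspace of \<open>K\<close> is a fractional ideal of \<open>R\<close>, so every nonzero subspace has a
  nonzero residual, which bounds the degree.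
\<close>
lemma dimension_2_of_clifford_regular:
  assumes cl: "clifford_regular L (preimage D)" and ne: "D.Q \<noteq> carrier K"
  shows "K.dimension 2 D.Q (carrier K)"
proof (rule K.dimension_2_of_square_residuals[OF D.quot_field_subfield ne])
  fix V assume V: "V \<subseteq> carrier K" "\<And>u v. u \<in> V \<Longrightarrow> v \<in> V \<Longrightarrow> u \<oplus>\<^bsub>K\<^esub> v \<in> V"
    "\<And>c v. c \<in> D.Q \<Longrightarrow> v \<in> V \<Longrightarrow> c \<otimes>\<^bsub>K\<^esub> v \<in> V" "\<one>\<^bsub>K\<^esub> \<in> V"
  have sub: "D_submodule V" unfolding D_submodule_def
    using V subsetD[OF D.A_in_Q] K.one_not_zero by blast
  have "preimage V \<in> R.FI"
    using preimage_fractional_ideal[OF sub m_conductor(1) m(3)] m_conductor(2) preimage_T by blast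
  then have "K.clifford_ideal V"
    using clifford_ideal_of_preimage[OF sub] cl R.clifford_regular_iff by blast
  then show "\<exists>w\<in>K.square_residual V. w \<noteq> \<zero>\<^bsub>K\<^esub>"
    using K.clifford_ideal_residual_nonzero[OF _ V(1,4)] by simp
qed

lemma dimension_le_2_of_clifford_regular:
  assumes cl: "clifford_regular L (preimage D)"
  shows "\<exists>n\<le>2. K.dimension n D.Q (carrier K)"
proof (cases "D.Q = carrier K")
  case True
  then have "K.dimension 1 D.Q (carrier K)" using K.dimension_one[OF D.quot_field_subfield] by simp
  then show ?thesis by (intro exI[of _ 1]) simp
next
  case False
  then show ?thesis using dimension_2_of_clifford_regular[OF cl] by blast
qed

text \<open>
  Write \<open>v + n = 1\<close> with \<open>v = u s\<close> and \<open>n\<close> in the kernel. Since \<open>\<phi> v = 1\<close>, \<open>n\<close> does not divide \<open>v\<close>; so \<open>v\<close>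
  divides \<open>n\<close>, and \<open>v\<^sup>-\<^sup>1 = 1 + v\<^sup>-\<^sup>1 n\<close> lies in \<open>T\<close>.
\<close>
lemma valuation_local:
  assumes val: "valuation_domain L T" and u: "u \<in> T" "\<phi> u \<noteq> \<zero>\<^bsub>K\<^esub>"
  shows "inv u \<in> T"
proof -
  obtain s n where sn: "s \<in> T" "n \<in> T" "\<phi> n = \<zero>\<^bsub>K\<^esub>" "u \<otimes> s \<oplus> n = \<one>"
    using exists_inverse_mod_kernel u by blast
  define v where "v = u \<otimes> s"
  have vT: "v \<in> T" unfolding v_def using A_props(6) u sn by blast
  have c: "u \<in> carrier L" "s \<in> carrier L" "n \<in> carrier L" "v \<in> carrier L" "inv u \<in> carrier L"
    using u sn vT A_carrier field_inv(1)[of u] phi_zero by auto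
  have u0: "u \<noteq> \<zero>" using u phi_zero by auto
  have "\<phi> v \<oplus>\<^bsub>K\<^esub> \<phi> n = \<one>\<^bsub>K\<^esub>" using phi_add[OF vT sn(2)] sn(4) phi_one v_def by simp
  then have pv: "\<phi> v = \<one>\<^bsub>K\<^esub>" using sn(3) phi_carrier[OF vT] by simp
  have v0: "v \<noteq> \<zero>" using pv phi_zero K.one_not_zero by auto
  have "inv v \<otimes> n \<in> T"
  proof (rule ccontr)
    assume "inv v \<otimes> n \<notin> T"
    then have n: "n \<noteq> \<zero>" "inv n \<otimes> v \<in> T"
      using valuation_total[OF val _ _ v0] A_in_Q vT sn(2) by blast+
    have "v = n \<otimes> (inv n \<otimes> v)" using n(1) c by (simp add: inv_cancel)
    then have "\<phi> v = \<phi> n \<otimes>\<^bsub>K\<^esub> \<phi> (inv n \<otimes> v)" using phi_mult[OF sn(2) n(2)] by simp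
    then have "\<phi> v = \<zero>\<^bsub>K\<^esub>" using sn(3) phi_carrier[OF n(2)] by simp
    then show False using pv by simp
  qed
  moreover have "inv v = inv v \<otimes> (v \<oplus> n)"
    using sn(4) c v0 unfolding v_def[symmetric] by (simp add: field_inv)
  then have "inv v = \<one> \<oplus> inv v \<otimes> n" using c v0 by (simp add: r_distr field_inv)
  ultimately have "inv v \<in> T" using A_props(3,7) by metis
  moreover have "inv v = inv u \<otimes> inv s"
    unfolding v_def using inv_mult c u0 v0 v_def by force
  then have "s \<otimes> inv v = inv u \<otimes> (s \<otimes> inv s)"
    using c v0 field_inv(1)[of s] v_def by (cases "s = \<zero>") (simp_all add: m_ac)
  then have "s \<otimes> inv v = inv u" using c v0 v_def by (cases "s = \<zero>") (simp_all add: field_inv)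
  ultimately show ?thesis using A_props(6)[OF sn(1)] by metis
qed

text \<open>
  If \<open>I\<close> is not a \<open>T\<close>-module, choose \<open>x \<in> I\<close> and \<open>t \<in> T\<close> with \<open>t x \<notin> I\<close>, and let \<open>M\<close> be the kernel. An \<open>i \<in> I\<close>
  outside \<open>x T\<close> would satisfy \<open>x \<in> M i\<close> and hence \<open>t x \<in> M i \<subseteq> I\<close>. So \<open>I = x J\<close> with \<open>J \<subseteq> T\<close>, and
  \<open>1 \<in> J\<close> gives \<open>R \<subseteq> J\<close>. The image of \<open>J\<close> in \<open>K\<close> is a subspace that contains \<open>1\<close> but not \<open>\<phi> t\<close>; in
  degree two it is therefore \<open>k\<close>, and \<open>J = R\<close>.
\<close>
lemma fractional_ideal_dichotomy:
  assumes val: "valuation_domain L T" and DQ: "D = D.Q"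
    and dim: "K.dimension 2 D.Q (carrier K)" and I: "I \<in> R.FI"
  shows "I \<in> FI \<or> (\<exists>x\<in>R.Q. x \<noteq> \<zero> \<and> I = x <# preimage D)"
proof (cases "\<forall>t\<in>T. \<forall>i\<in>I. t \<otimes> i \<in> I")
  case True
  then show ?thesis using T_over_R(3)[OF I] by blast
next
  case False
  note ID = R.FI_D[OF I]
  obtain t x where tx: "t \<in> T" "x \<in> I" "t \<otimes> x \<notin> I" using False by blast
  have xc: "x \<in> carrier L" and tc: "t \<in> carrier L" using tx ID(2) A_carrier by auto
  have x0: "x \<noteq> \<zero>" using tx(3) tc ID(3) by auto
  have IQ: "i \<in> Q" if "i \<in> I" for i using that ID(1) T_over_R(1) by blast
  have div: "inv x \<otimes> i \<in> T" if i: "i \<in> I" for i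
  proof (rule ccontr)
    assume n: "inv x \<otimes> i \<notin> T"
    note i0 = valuation_total[OF val IQ[OF tx(2)] IQ[OF i] x0 n]
    have ic: "i \<in> carrier L" using i ID(2) by blast
    let ?u = "inv i \<otimes> x"
    have inv_u: "inv ?u = inv x \<otimes> i"
    proof -
      have "inv (inv i) = i" using comm_inv_char[of "inv i" i] ic i0(1) by (simp add: field_inv)
      then show ?thesis
        using inv_mult[of "inv i" x] ic i0(1) xc x0 m_comm[of i "inv x"] by (simp add: field_inv)
    qed
    show False
    proof (cases "\<phi> ?u = \<zero>\<^bsub>K\<^esub>")
      case True
      have "(t \<otimes> ?u) \<otimes> i \<in> I" using ID(5)[OF kernel_mult(2)[OF i0(2) True tx(1)] i] .
      moreover have "(t \<otimes> ?u) \<otimes> i = (inv i \<otimes> i) \<otimes> (t \<otimes> x)"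
        using tc xc ic field_inv(1)[OF ic i0(1)] by (simp add: m_ac)
      moreover have "\<dots> = t \<otimes> x" using tc xc ic i0(1) by (simp add: field_inv)
      ultimately show False using tx(3) by simp
    next
      case False
      then show False using valuation_local[OF val i0(2)] n inv_u by simp
    qed
  qed
  define J where "J = {y \<in> T. x \<otimes> y \<in> I}"
  have JI: "I = x <# J"
  proof
    show "I \<subseteq> x <# J"
    proof
      fix i assume i: "i \<in> I"
      then have ic: "i \<in> carrier L" using ID(2) by blast
      have "x \<otimes> (inv x \<otimes> i) = i" using ic xc x0 by (simp add: inv_cancel)
      moreover have "inv x \<otimes> i \<in> J" unfolding J_def using div[OF i] i calculation by simp
      ultimately show "i \<in> x <# J" using l_coset_memI by metis
    qed
    show "x <# J \<subseteq> I" unfolding l_coset_def J_def by blast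
  qed
  have closed: "x \<otimes> (r \<otimes> y) \<in> I" if r: "r \<in> preimage D" and y: "y \<in> J" for r y
  proof -
    have "r \<otimes> (x \<otimes> y) \<in> I" using ID(5) r y unfolding J_def by blast
    moreover have "r \<otimes> (x \<otimes> y) = x \<otimes> (r \<otimes> y)"
      using r y xc A_carrier preimage_T unfolding J_def by (simp add: m_lcomm)
    ultimately show ?thesis by simp
  qed
  have one: "\<one> \<in> J" unfolding J_def using A_props(3) xc tx(2) by simp
  have RJ: "preimage D \<subseteq> J"
  proof
    fix r assume r: "r \<in> preimage D"
    then show "r \<in> J" using closed[OF r one] A_carrier[OF preimage_T[OF r]] preimage_T[OF r]
      unfolding J_def by simp
  qed
  have Jadd: "y \<oplus> y' \<in> J" if "y \<in> J" "y' \<in> J" for y y'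
    using that ID(4) A_props(7) xc A_carrier unfolding J_def by (simp add: r_distr)
  have "\<phi> ` J = D.Q"
  proof (rule K.proper_subspace_of_dimension_2[OF D.quot_field_subfield dim])
    show "\<phi> ` J \<subseteq> carrier K" using phi_carrier unfolding J_def by blast
    show "\<one>\<^bsub>K\<^esub> \<in> \<phi> ` J" using one phi_one by (metis imageI)
    show "u \<oplus>\<^bsub>K\<^esub> v \<in> \<phi> ` J" if "u \<in> \<phi> ` J" "v \<in> \<phi> ` J" for u v
    proof -
      obtain y y' where "y \<in> J" "y' \<in> J" "u = \<phi> y" "v = \<phi> y'" using \<open>u \<in> \<phi> ` J\<close> \<open>v \<in> \<phi> ` J\<close> by blast
      then show ?thesis using Jadd phi_add[of y y'] unfolding J_def by (metis (no_types, lifting) imageI mem_Collect_eq)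
    qed
    show "c \<otimes>\<^bsub>K\<^esub> v \<in> \<phi> ` J" if c: "c \<in> D.Q" and v: "v \<in> \<phi> ` J" for c v
    proof -
      obtain y where y: "y \<in> J" "v = \<phi> y" using v by blast
      obtain d where d: "d \<in> T" "\<phi> d = c" using phi_surj D.Q_carrier[OF c] by blast
      have yT: "y \<in> T" using y unfolding J_def by blast
      have "d \<in> preimage D" using d c DQ unfolding preimage_def by simp
      then have "d \<otimes> y \<in> J" using closed[OF _ y(1)] A_props(6)[OF d(1) yT] unfolding J_def by simp
      then show ?thesis using phi_mult[OF d(1) yT] d y by (metis imageI)
    qed
    show "\<phi> ` J \<noteq> carrier K"
    proof
      assume "\<phi> ` J = carrier K"
      then obtain y where y: "y \<in> J" "\<phi> y = \<phi> t" using phi_carrier[OF tx(1)] by (metis imageE)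
      have yT: "y \<in> T" and yc: "y \<in> carrier L" using y A_carrier unfolding J_def by auto
      have "\<phi> (t \<ominus> y) = \<zero>\<^bsub>K\<^esub>"
        using phi_minus(2)[OF tx(1) yT] y phi_carrier[OF tx(1)] by (simp add: K.minus_eq K.r_neg)
      then have "t \<ominus> y \<in> preimage D"
        using phi_minus(1)[OF tx(1) yT] D.A_props(2) unfolding preimage_def by simp
      then have "y \<oplus> (t \<ominus> y) \<in> J" using Jadd y RJ by blast
      moreover have "y \<oplus> (t \<ominus> y) = t" using yc tc by algebra
      ultimately show False using tx(3) m_comm[OF xc tc] unfolding J_def by simp
    qed
  qed
  then have "J \<subseteq> preimage D" using DQ unfolding J_def preimage_def by blast
  then have "J = preimage D" using RJ by blast
  then show ?thesis using JI x0 subsetD[OF ID(1) tx(2)] by blast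
qed

lemma square_of_principal:
  assumes "I \<in> R.FI" "x \<in> R.Q" "I = x <# preimage D"
  shows "I \<cdot> I = x <# I"
  using R.ideal_prod_principal[OF assms(1,2)] assms(3) by simp

lemma clifford_regular_of_dimension_2:
  assumes val: "valuation_domain L T" and DQ: "D = D.Q" and dim: "K.dimension 2 D.Q (carrier K)"
  shows "clifford_regular L (preimage D)"
  unfolding R.clifford_regular_iff
proof
  fix I assume I: "I \<in> R.FI"
  consider "I \<in> FI" | x where "x \<in> R.Q" "x \<noteq> \<zero>" "I = x <# preimage D"
    using fractional_ideal_dichotomy[OF val DQ dim I] by blast
  then show "clifford_ideal I"
  proof cases
    case 1
    then show ?thesis using valuation_imp_clifford_ideal[OF val] by blast
  next
    case 2
    then show ?thesis
      using square_similar_imp_clifford_ideal[OF R.FI_D(2)[OF I] R.Q_carrier]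
        square_of_principal[OF I] by blast
  qed
qed

lemma boole_regular_of_dimension_2:
  assumes val: "valuation_domain L T" and sd: "strongly_discrete (L\<lparr>carrier := T\<rparr>)"
    and DQ: "D = D.Q" and dim: "K.dimension 2 D.Q (carrier K)"
  shows "boole_regular L (preimage D)"
  unfolding R.boole_regular_iff
proof
  fix I assume I: "I \<in> R.FI"
  consider "I \<in> FI" | x where "x \<in> R.Q" "x \<noteq> \<zero>" "I = x <# preimage D"
    using fractional_ideal_dichotomy[OF val DQ dim I] by blast
  then show "\<exists>c\<in>R.Q. c \<noteq> \<zero> \<and> I \<cdot> I = c <# I"
  proof cases
    case 1
    then show ?thesis using strongly_discrete_valuation_square[OF val sd] T_over_R(1) by blast
  next
    case 2
    then show ?thesis using square_of_principal[OF I] by blast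
  qed
qed

end

section \<open>The pullback theorem\<close>

theorem theorem5p1:
  fixes L :: "('a, 'b) ring_scheme"
    and T M R :: "'a set"
    and K :: "'a set ring"
    and D k :: "'a set set"
  assumes "field L"
    and "subring T L"
    and "maximalideal M (L\<lparr>carrier := T\<rparr>)"
    and "K = (L\<lparr>carrier := T\<rparr>) Quot M"
    and "subring D K" and "D \<noteq> carrier K"
    and "k = quot_field K D"
    and "R = {x \<in> T. M +>\<^bsub>L\<^esub> x \<in> D}"
  shows
    "(clifford_regular L R \<longrightarrow>
        clifford_regular L T \<and> clifford_regular K D \<and>
        (M \<noteq> {\<zero>\<^bsub>L\<^esub>} \<longrightarrow> (\<exists>n\<le>2. ring.dimension K n k (carrier K)))) \<and>
     (boole_regular L R \<longrightarrow>
        boole_regular L T \<and> boole_regular K D \<and>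
        (M \<noteq> {\<zero>\<^bsub>L\<^esub>} \<longrightarrow> (\<exists>n\<le>2. ring.dimension K n k (carrier K)))) \<and>
     (M \<noteq> {\<zero>\<^bsub>L\<^esub>} \<and> D = k \<longrightarrow>
        (valuation_domain L T \<longrightarrow>
           (clifford_regular L R \<longleftrightarrow> ring.dimension K 2 k (carrier K))) \<and>
        (valuation_domain L T \<and> strongly_discrete (L\<lparr>carrier := T\<rparr>) \<longrightarrow>
           (boole_regular L R \<longleftrightarrow> ring.dimension K 2 k (carrier K))))"
proof -
  let ?\<phi> = "\<lambda>x. M +>\<^bsub>L\<^esub> x"
  let ?T = "L\<lparr>carrier := T\<rparr>"
  interpret T: domain_in_field L T
    using assms(1,2) unfolding domain_in_field_def domain_in_field_axioms_def by blast
  interpret M: maximalideal M ?T by (rule assms(3))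
  have coset: "M +>\<^bsub>?T\<^esub> x = ?\<phi> x" for x
    by (simp add: a_r_coset_def r_coset_def)
  have field_K: "field K" unfolding assms(4) by (rule M.quotient_is_field[OF T.A_cring])
  have hom: "?\<phi> \<in> ring_hom ?T K" using M.rcos_ring_hom unfolding assms(4) coset .
  have surj: "?\<phi> ` T = carrier K"
    unfolding assms(4) FactRing_def A_RCOSETS_def' coset[symmetric] by auto
  interpret residue_pullback L T K ?\<phi> D
    using T.domain_in_field_axioms field_K hom surj assms(5)
    unfolding residue_pullback_def residue_pullback_axioms_def by blast
  have zero_K: "\<zero>\<^bsub>K\<^esub> = M" unfolding assms(4) FactRing_def by simp
  have ker: "?\<phi> x = \<zero>\<^bsub>K\<^esub> \<longleftrightarrow> x \<in> M" if "x \<in> T" for x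
  proof
    show "x \<in> M" if "?\<phi> x = \<zero>\<^bsub>K\<^esub>"
      using M.a_rcos_self[of x] that \<open>x \<in> T\<close> unfolding zero_K coset by simp
    show "?\<phi> x = \<zero>\<^bsub>K\<^esub>" if "x \<in> M"
      using M.a_rcos_const[OF that] unfolding zero_K coset .
  qed
  have R: "R = preimage D" unfolding assms(8) preimage_def by blast
  have MT: "M \<subseteq> T" using M.a_subset by simp
  show ?thesis
  proof (cases "M = {\<zero>\<^bsub>L\<^esub>}")
    case True
    then have "boole_regular L T" using boole_regular_T_of_trivial_kernel ker by blast
    then show ?thesis
      using True clifford_regular_D boole_regular_D T.boole_imp_clifford unfolding R by blast
  next
    case False
    have "\<zero>\<^bsub>L\<^esub> \<in> M" using additive_subgroup.zero_closed[OF M.is_additive_subgroup] by simp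
    then obtain m where m: "m \<in> M" "m \<noteq> \<zero>\<^bsub>L\<^esub>" using False by blast
    interpret nontrivial_residue_pullback L T K ?\<phi> D m
      using m MT ker by unfold_locales auto
    have k: "D = k \<Longrightarrow> quot_field K D \<noteq> carrier K" using assms(6,7) by simp
    show ?thesis
      using clifford_regular_T boole_regular_T clifford_regular_D boole_regular_D
        dimension_le_2_of_clifford_regular dimension_2_of_clifford_regular R.boole_imp_clifford
        clifford_regular_of_dimension_2 boole_regular_of_dimension_2 k
      unfolding R assms(7) by blast
  qed
qed

end
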